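(* Let $k \ge 2$, let $X$ be a data set with $n$ items, and let $\kappa^+,\kappa^-\in\mathbb{Z}_+^k$ with $\kappa^+\ge\kappa^-$ componentwise. For the bounded-size partition polytope $BPP(\kappa^+,\kappa^-)$, assume the clusters are indexed so that $\kappa_1^+\ge\cdots\ge\kappa_k^+$, and let $i_1$ denote the index minimizing $\kappa_i^+-\kappa_i^-$. If $\sum_{i=1}^k\kappa_i^+ > n+k-2$ and if $\kappa_i^+>\kappa_i^-$ for all $i\neq i_1$, then the circuit diameter of $BPP(\kappa^+,\kappa^-)$ is at most $$\kappa_1^+ + \max\left\{\kappa_2^+,\ \frac{1}{2}\sum_{i\neq i_1}(\kappa_i^+-\kappa_i^-)\right\} + 2(k-2),$$ where the sum runs over $i\in\{1,\dots,k\}\setminus\{i_1\}$.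
   Context: For a data set $X=\{x_1,\dots,x_n\}$ and $\kappa^+,\kappa^-\in\mathbb{Z}_+^k$ with $\kappa^+\ge\kappa^-$, the bounded-size partition polytope $BPP(\kappa^+,\kappa^-)\subset\mathbb{R}^{k\times n}$ is the set of all $y=(y_{ij})$ satisfying $\sum_{i=1}^k y_{ij}=1$ for $j=1,\dots,n$; $\sum_{j=1}^n y_{ij}\ge\kappa_i^-$ and $\sum_{j=1}^n y_{ij}\le\kappa_i^+$ for $i=1,\dots,k$; and $y_{ij}\ge 0$ for all $i,j$. It is a 0/1-polytope whose vertices correspond to the partitions $(C_1,\dots,C_k)$ of $X$ into $k$ labeled clusters with $\kappa_i^-\le|C_i|\le\kappa_i^+$ for all $i$ (with $y_{ij}=1$ iff $x_j\in C_i$). For a polyhedron $P=\{\mathbf{x}\in\mathbb{R}^N: A\mathbf{x}=\mathbf{b},\ B\mathbf{x}\le\mathbf{d}\}$, the circuits of $P$ are the vectors $\mathbf{g}\in\ker(A)\setminus\{\mathbf{0}\}$, normalized to coprime integer components, for which $B\mathbf{g}$ is support-minimal over $\{B\mathbf{x}:\mathbf{x}\in\ker(A)\setminus\{\mathbf{0}\}\}$. For $BPP(\kappa^+,\kappa^-)$, $A$ consists of the rows of the equality constraints and $B$ of the rows of all the inequality constraints above. A circuit walk from a vertex $\mathbf{y}$ to a vertex $\mathbf{y}'$ of $P$ is a sequence $\mathbf{y}=\mathbf{y}^0,\mathbf{y}^1,\dots,\mathbf{y}^m=\mathbf{y}'$ of points of $P$ such that for each $r$, $\mathbf{y}^{r+1}-\mathbf{y}^r=\alpha_r\mathbf{g}^r$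 for a circuit $\mathbf{g}^r$ and some $\alpha_r>0$, where the step is of maximal length ($\mathbf{y}^r+\alpha\mathbf{g}^r\notin P$ for all $\alpha>\alpha_r$); $m$ is its number of steps. The circuit distance from $\mathbf{y}$ to $\mathbf{y}'$ is the minimum number of steps of such a walk, and the circuit diameter of $P$ is the maximum circuit distance over all pairs of vertices, i.e. the minimum number of steps sufficient to join any pair of vertices by a circuit walk. *)

theory Defs
  imports "HOL-Analysis.Analysis"
begin

definition polyhedron_of ::
  "real^'v^'a \<Rightarrow> real^'a \<Rightarrow> real^'v^'b \<Rightarrow> real^'b \<Rightarrow> (real^'v) set" where
  "polyhedron_of A b B d = {x. A *v x = b \<and> (\<forall>i. (B *v x) $ i \<le> d $ i)}"

definition supp :: "real^'b \<Rightarrow> 'b set" where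
  "supp x = {i. x $ i \<noteq> 0}"

definition coprime_integral :: "real^'v \<Rightarrow> bool" where
  "coprime_integral g \<longleftrightarrow>
     (\<exists>z :: 'v \<Rightarrow> int. (\<forall>i. g $ i = of_int (z i)) \<and> Gcd (range z) = 1)"

definition circuits :: "real^'v^'a \<Rightarrow> real^'v^'b \<Rightarrow> (real^'v) set" where
  "circuits A B = {g. A *v g = 0 \<and> g \<noteq> 0 \<and> coprime_integral g \<and>
     \<not> (\<exists>x. A *v x = 0 \<and> x \<noteq> 0 \<and> supp (B *v x) \<subset> supp (B *v g))}"

text \<open>The intermediate points need not be vertices.\<close>

definition circuit_walk ::
  "real^'v^'a \<Rightarrow> real^'a \<Rightarrow> real^'v^'b \<Rightarrow> real^'b \<Rightarrow> nat \<Rightarrow> (nat \<Rightarrow> real^'v) \<Rightarrow> bool" where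
  "circuit_walk A b B d m y \<longleftrightarrow>
     (\<forall>r\<le>m. y r \<in> polyhedron_of A b B d) \<and>
     (\<forall>r<m. \<exists>g\<in>circuits A B. \<exists>\<alpha>>0. y (Suc r) - y r = \<alpha> *\<^sub>R g \<and>
        (\<forall>\<beta>>\<alpha>. y r + \<beta> *\<^sub>R g \<notin> polyhedron_of A b B d))"

text \<open>The distance is \<open>\<infinity>\<close> if there is no walk, so a finite bound on it includes the
  existence of a walk. The diameter of a polyhedron without vertices is \<open>0\<close>.\<close>

definition circuit_distance ::
  "real^'v^'a \<Rightarrow> real^'a \<Rightarrow> real^'v^'b \<Rightarrow> real^'b \<Rightarrow> real^'v \<Rightarrow> real^'v \<Rightarrow> enat" where
  "circuit_distance A b B d u v =
     Inf {enat m | m. \<exists>y. circuit_walk A b B d m y \<and> y 0 = u \<and> y m = v}"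

definition circuit_diameter ::
  "real^'v^'a \<Rightarrow> real^'a \<Rightarrow> real^'v^'b \<Rightarrow> real^'b \<Rightarrow> enat" where
  "circuit_diameter A b B d =
     Sup {circuit_distance A b B d u v | u v.
       u extreme_point_of polyhedron_of A b B d \<and> v extreme_point_of polyhedron_of A b B d}"

text \<open>Clusters are indexed by the type \<open>'k\<close> and data items by the type \<open>'n\<close>; the variable
  \<open>y\<^sub>i\<^sub>j\<close> is the coordinate \<open>(i, j)\<close>. The inequality rows, all written as upper bounds, are
  indexed by \<open>Inl (Inl i)\<close> (upper size bound of cluster \<open>i\<close>), \<open>Inl (Inr i)\<close> (negated lower size
  bound of cluster \<open>i\<close>) and \<open>Inr (i, j)\<close> (negated nonnegativity of \<open>y\<^sub>i\<^sub>j\<close>).\<close>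

definition bpp_A :: "real^('k::finite \<times> 'n::finite)^'n" where
  "bpp_A = (\<chi> j p. if snd p = j then 1 else 0)"

definition bpp_b :: "real^'n::finite" where
  "bpp_b = (\<chi> j. 1)"

definition bpp_B :: "real^('k::finite \<times> 'n::finite)^(('k + 'k) + 'k \<times> 'n)" where
  "bpp_B = (\<chi> c p. case c of
      Inl (Inl i) \<Rightarrow> if fst p = i then 1 else 0
    | Inl (Inr i) \<Rightarrow> if fst p = i then - 1 else 0
    | Inr q \<Rightarrow> if p = q then - 1 else 0)"

definition bpp_d ::
  "('k::finite \<Rightarrow> nat) \<Rightarrow> ('k \<Rightarrow> nat) \<Rightarrow> real^(('k + 'k) + 'k \<times> 'n::finite)" where
  "bpp_d \<kappa>p \<kappa>m = (\<chi> c. case c of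
      Inl (Inl i) \<Rightarrow> real (\<kappa>p i)
    | Inl (Inr i) \<Rightarrow> - real (\<kappa>m i)
    | Inr q \<Rightarrow> 0)"

definition BPP :: "('k::finite \<Rightarrow> nat) \<Rightarrow> ('k \<Rightarrow> nat) \<Rightarrow> (real^('k \<times> 'n::finite)) set" where
  "BPP \<kappa>p \<kappa>m = {y.
     (\<forall>j. (\<Sum>i\<in>UNIV. y $ (i, j)) = 1) \<and>
     (\<forall>i. (\<Sum>j\<in>UNIV. y $ (i, j)) \<ge> real (\<kappa>m i) \<and> (\<Sum>j\<in>UNIV. y $ (i, j)) \<le> real (\<kappa>p i)) \<and>
     (\<forall>i j. y $ (i, j) \<ge> 0)}"

lemma bpp_A_mult: "(bpp_A *v y) $ j = (\<Sum>i\<in>UNIV. y $ (i, j))"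
  for y :: "real^('k::finite \<times> 'n::finite)"
proof -
  have "(bpp_A *v y) $ j = (\<Sum>p\<in>UNIV. (if snd p = j then 1 else 0) * y $ p)"
    by (simp add: bpp_A_def matrix_vector_mult_def)
  also have "\<dots> = (\<Sum>i\<in>UNIV. \<Sum>j'\<in>UNIV. (if j' = j then 1 else 0) * y $ (i, j'))"
    by (simp add: UNIV_Times_UNIV[symmetric] sum.cartesian_product case_prod_beta del: UNIV_Times_UNIV)
  also have "\<dots> = (\<Sum>i\<in>UNIV. \<Sum>j'\<in>UNIV. if j' = j then y $ (i, j') else 0)"
    by (intro sum.cong) auto
  finally show ?thesis by simp
qed

lemma bpp_B_mult:
  fixes y :: "real^('k::finite \<times> 'n::finite)"
  shows "(bpp_B *v y) $ Inl (Inl i) = (\<Sum>j\<in>UNIV. y $ (i, j))"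
    and "(bpp_B *v y) $ Inl (Inr i) = - (\<Sum>j\<in>UNIV. y $ (i, j))"
    and "(bpp_B *v y) $ Inr (i, j) = - y $ (i, j)"
proof -
  have *: "(\<Sum>p\<in>UNIV. (if fst p = i then c else 0) * y $ p) = c * (\<Sum>j\<in>UNIV. y $ (i, j))" for c :: real
  proof -
    have "(\<Sum>p\<in>UNIV. (if fst p = i then c else 0) * y $ p)
        = (\<Sum>a\<in>UNIV. \<Sum>j\<in>UNIV. (if a = i then c else 0) * y $ (a, j))"
      by (simp add: UNIV_Times_UNIV[symmetric] sum.cartesian_product case_prod_beta del: UNIV_Times_UNIV)
    also have "\<dots> = (\<Sum>a\<in>UNIV. if a = i then c * (\<Sum>j\<in>UNIV. y $ (a, j)) else 0)"
      by (intro sum.cong) (auto simp: sum_distrib_left)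
    finally show ?thesis by simp
  qed
  show "(bpp_B *v y) $ Inl (Inl i) = (\<Sum>j\<in>UNIV. y $ (i, j))"
    using *[of 1] by (simp add: bpp_B_def matrix_vector_mult_def)
  show "(bpp_B *v y) $ Inl (Inr i) = - (\<Sum>j\<in>UNIV. y $ (i, j))"
    using *[of "- 1"] by (simp add: bpp_B_def matrix_vector_mult_def)
  show "(bpp_B *v y) $ Inr (i, j) = - y $ (i, j)"
    by (simp add: bpp_B_def matrix_vector_mult_def if_distrib[of "\<lambda>x. x * _"] cong: if_cong)
qed

lemma BPP_eq_polyhedron_of:
  "(BPP \<kappa>p \<kappa>m :: (real^('k::finite \<times> 'n::finite)) set) =
     polyhedron_of bpp_A bpp_b bpp_B (bpp_d \<kappa>p \<kappa>m)"
proof -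
  have split: "(\<forall>c. P c) \<longleftrightarrow>
      (\<forall>i. P (Inl (Inl i))) \<and> (\<forall>i. P (Inl (Inr i))) \<and> (\<forall>i j. P (Inr (i, j)))"
    for P :: "('k + 'k) + 'k \<times> 'n \<Rightarrow> bool"
    by (simp add: split_sum_all)
  have "y \<in> BPP \<kappa>p \<kappa>m \<longleftrightarrow> y \<in> polyhedron_of bpp_A bpp_b bpp_B (bpp_d \<kappa>p \<kappa>m)"
    for y :: "real^('k \<times> 'n)"
    unfolding BPP_def polyhedron_of_def mem_Collect_eq split vec_eq_iff[of "bpp_A *v y"]
    by (auto simp: bpp_A_mult bpp_B_mult bpp_b_def bpp_d_def)
  then show ?thesis by blast
qed

end

theory Submission
  imports Defs
begin

text \<open>A vertex of the polytope is an assignment \<open>f\<close> of the items to the clusters. Moving one item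
along each edge of a simple cycle or a simple path of clusters is a circuit step of maximal
length, provided that the end points of a path keep their size bounds.

To get from \<open>f\<close> to \<open>g\<close>, draw an edge \<open>f x \<rightarrow> g x\<close> for every item with \<open>f x \<noteq> g x\<close>. The in- and
outdegree of cluster \<open>i\<close> are at most \<open>\<kappa>\<^sup>+ i\<close>, and the graph becomes Eulerian if the clusters that
have to shrink or grow are joined to two additional hubs that share the total surplus \<open>H\<close>. If all
degrees are at most \<open>c\<close> and \<open>H \<le> 2c\<close>, Hall's theorem gives vertex-disjoint cycles through all
vertices of degree \<open>c\<close>, that is, cycles of clusters and at most two paths from a shrinking to a
growing cluster. All of these together can be realised in only two circuit steps: the first
one runs through all of them and misplaces one item in each, the second one corrects this. A
single component takes one step. So with \<open>c = max \<kappa>\<^sub>2 \<lceil>H/2\<rceil>\<close>, one first lowers the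
degree of the largest cluster to \<open>c\<close> with one step per unit, and then all degrees to \<open>0\<close> with two
steps per unit, which takes at most \<open>max \<kappa>\<^sub>1 c + c\<close> steps; and \<open>2H\<close> is at most the sum of all
\<open>\<kappa>\<^sup>+ i - \<kappa>\<^sup>- i\<close>.\<close>

subsection \<open>Permutations in the support of a matrix\<close>

text \<open>Halmos-Vaughan induction. If some nonempty proper subset \<open>S\<close> has exactly
  \<open>card S\<close> neighbours, it is matched first and the rest is matched outside its
  neighbourhood. Otherwise every such subset has a spare neighbour, so any single pair can be fixed
  and removed.\<close>

lemma hall:
  fixes N :: "'a \<Rightarrow> 'b set"
  assumes "finite A" "\<And>x. x \<in> A \<Longrightarrow> finite (N x)"
    "\<And>S. S \<subseteq> A \<Longrightarrow> card S \<le> card (\<Union>(N ` S))"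
  shows "\<exists>\<pi>. inj_on \<pi> A \<and> (\<forall>x\<in>A. \<pi> x \<in> N x)"
  using assms
proof (induction A arbitrary: N rule: finite_psubset_induct)
  case (psubset A)
  have fin: "finite (\<Union>(N ` S))" if "S \<subseteq> A" for S
    using that psubset.hyps psubset.prems(1) by (meson finite_UN finite_subset subsetD)
  show ?case
  proof (cases "A = {}")
    case False
    then obtain x where x: "x \<in> A" by blast
    show ?thesis
    proof (cases "\<exists>S. S \<subset> A \<and> S \<noteq> {} \<and> card S = card (\<Union>(N ` S))")
      case True
      then obtain S where S: "S \<subset> A" "S \<noteq> {}" "card S = card (\<Union>(N ` S))" by blast
      have "\<exists>\<pi>. inj_on \<pi> S \<and> (\<forall>x\<in>S. \<pi> x \<in> N x)"
        using S psubset.prems by (intro psubset.IH) auto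
      then obtain p where p: "inj_on p S" "\<forall>x\<in>S. p x \<in> N x" by blast
      have "\<exists>\<pi>. inj_on \<pi> (A - S) \<and> (\<forall>x\<in>A - S. \<pi> x \<in> N x - \<Union>(N ` S))"
      proof (rule psubset.IH)
        show "A - S \<subset> A" using S by blast
        fix T assume T: "T \<subseteq> A - S"
        have fS: "finite S" "finite T" using S T psubset.hyps finite_subset by blast+
        have "card T + card S = card (T \<union> S)"
          using T fS by (subst card_Un_disjoint) auto
        also have "\<dots> \<le> card (\<Union>(N ` (T \<union> S)))"
          using T S by (intro psubset.prems(2)) auto
        also have "\<Union>(N ` (T \<union> S)) = \<Union>((\<lambda>x. N x - \<Union>(N ` S)) ` T) \<union> \<Union>(N ` S)" by blast
        also have "card \<dots> \<le> card (\<Union>((\<lambda>x. N x - \<Union>(N ` S)) ` T)) + card (\<Union>(N ` S))"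
          by (rule card_Un_le)
        finally show "card T \<le> card (\<Union>((\<lambda>x. N x - \<Union>(N ` S)) ` T))" using S(3) by simp
      qed (use psubset.prems in auto)
      then obtain q where q: "inj_on q (A - S)" "\<forall>x\<in>A - S. q x \<in> N x - \<Union>(N ` S)" by blast
      have "inj_on (\<lambda>x. if x \<in> S then p x else q x) A"
        using p q unfolding inj_on_def by (smt (verit) DiffE DiffI UN_I)
      then show ?thesis
        using p q by (intro exI[of _ "\<lambda>x. if x \<in> S then p x else q x"]) auto
    next
      case False
      have "N x \<noteq> {}" using psubset.prems(2)[of "{x}"] x by auto
      then obtain y where y: "y \<in> N x" by blast
      have "\<exists>\<pi>. inj_on \<pi> (A - {x}) \<and> (\<forall>z\<in>A - {x}. \<pi> z \<in> N z - {y})"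
      proof (rule psubset.IH)
        show "A - {x} \<subset> A" using x by blast
        fix T assume T: "T \<subseteq> A - {x}"
        show "card T \<le> card (\<Union>((\<lambda>z. N z - {y}) ` T))"
        proof (cases "T = {}")
          case F: False
          have "card T < card (\<Union>(N ` T))"
            using False F T x psubset.prems(2)[of T] by (metis Diff_subset insert_Diff insert_subset nat_less_le psubsetI subset_Diff_insert subset_trans)
          moreover have "\<Union>((\<lambda>z. N z - {y}) ` T) = \<Union>(N ` T) - {y}" by blast
          moreover have "card (\<Union>(N ` T)) - 1 \<le> card (\<Union>(N ` T) - {y})"
            by (simp add: card_Diff_singleton_if)
          ultimately show ?thesis by simp
        qed simp
      qed (use psubset.prems in auto)
      then obtain q where q: "inj_on q (A - {x})" "\<forall>z\<in>A - {x}. q z \<in> N z - {y}" by blast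
      have "inj_on (q(x := y)) A"
        using q unfolding inj_on_def by (metis (no_types, lifting) DiffE DiffI fun_upd_apply insertI1 singletonD)
      moreover have "\<forall>z\<in>A. (q(x := y)) z \<in> N z" using q y by auto
      ultimately show ?thesis by blast
    qed
  qed simp
qed

lemma positive_permutation:
  fixes m :: "'a::finite \<Rightarrow> 'a \<Rightarrow> real"
  assumes nonneg: "\<And>i j. m i j \<ge> 0" and "c > 0"
    and row: "\<And>i. (\<Sum>j\<in>UNIV. m i j) = c" and col: "\<And>j. (\<Sum>i\<in>UNIV. m i j) = c"
  obtains \<pi> where "bij \<pi>" "\<And>i. m i (\<pi> i) > 0"
proof -
  have "\<exists>\<pi>. inj_on \<pi> UNIV \<and> (\<forall>i\<in>UNIV. \<pi> i \<in> {j. m i j > 0})"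
  proof (rule hall)
    fix S :: "'a set"
    let ?T = "\<Union>((\<lambda>i. {j. m i j > 0}) ` S)"
    have "c * card S = (\<Sum>i\<in>S. \<Sum>j\<in>UNIV. m i j)" by (simp add: row)
    also have "\<dots> = (\<Sum>i\<in>S. \<Sum>j\<in>?T. m i j)"
      using nonneg by (intro sum.cong refl sum.mono_neutral_right) (auto simp: less_le)
    also have "\<dots> \<le> (\<Sum>i\<in>UNIV. \<Sum>j\<in>?T. m i j)"
      using nonneg by (intro sum_mono2) (auto intro: sum_nonneg)
    also have "\<dots> = (\<Sum>j\<in>?T. \<Sum>i\<in>UNIV. m i j)" by (rule sum.swap)
    also have "\<dots> = c * card ?T" by (simp add: col)
    finally show "card S \<le> card ?T" using \<open>c > 0\<close> by simp
  qed auto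
  then obtain \<pi> where "inj \<pi>" "\<And>i. m i (\<pi> i) > 0" by blast
  then show thesis using that finite_UNIV_inj_surj[of \<pi>] by (auto simp: bij_def)
qed

subsection \<open>Vertices and circuit steps\<close>

text \<open>A line with integral sum never contains exactly one nonintegral entry. Hence one can
  walk forever through nonintegral entries, alternating between moves within a column and within a
  row, until a row repeats. \<open>G\<close> carries alternating signs along the resulting
  cycle.\<close>

lemma noninteger_cycle:
  fixes Y :: "'a::finite \<Rightarrow> 'b::finite \<Rightarrow> real"
  assumes row: "\<And>i. (\<Sum>j\<in>UNIV. Y i j) \<in> \<int>" and col: "\<And>j. (\<Sum>i\<in>UNIV. Y i j) \<in> \<int>"
    and "Y a b \<notin> \<int>"
  obtains G :: "'a \<Rightarrow> 'b \<Rightarrow> real" and a' b'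
  where "\<And>i. (\<Sum>j\<in>UNIV. G i j) = 0" "\<And>j. (\<Sum>i\<in>UNIV. G i j) = 0"
    "\<And>i j. Y i j \<in> \<int> \<Longrightarrow> G i j = 0" "G a' b' \<noteq> 0"
proof -
  have other: "\<exists>q\<noteq>p. u q \<notin> \<int>" if "(\<Sum>q\<in>UNIV. u q) \<in> \<int>" "u p \<notin> \<int>"
    for u :: "'c::finite \<Rightarrow> real" and p
  proof (rule ccontr)
    assume "\<not> ?thesis"
    then have "(\<Sum>q\<in>UNIV - {p}. u q) \<in> \<int>" by (intro Ints_sum) auto
    moreover have "u p = (\<Sum>q\<in>UNIV. u q) - (\<Sum>q\<in>UNIV - {p}. u q)"
      by (simp add: sum_diff1)
    ultimately show False using that by (metis Ints_diff)
  qed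
  have "\<exists>w. \<forall>t::nat. (Y (fst (w t)) (snd (w t)) \<notin> \<int>) \<and>
      (fst (w (Suc t)) \<noteq> fst (w t) \<and> snd (w (Suc t)) \<noteq> snd (w t) \<and>
       Y (fst (w (Suc t))) (snd (w t)) \<notin> \<int>)"
  proof (rule dependent_nat_choice)
    show "\<exists>x. Y (fst x) (snd x) \<notin> \<int>" using assms(3) by (intro exI[of _ "(a, b)"]) simp
    fix x :: "'a \<times> 'b" and t :: nat
    assume x: "Y (fst x) (snd x) \<notin> \<int>"
    obtain i where i: "i \<noteq> fst x" "Y i (snd x) \<notin> \<int>"
      using other[OF col, of "fst x" "snd x"] x by blast
    obtain j where j: "j \<noteq> snd x" "Y i j \<notin> \<int>"
      using other[OF row, of i "snd x"] i by blast
    show "\<exists>y. Y (fst y) (snd y) \<notin> \<int> \<and> fst y \<noteq> fst x \<and> snd y \<noteq> snd x \<and> Y (fst y) (snd x) \<notin> \<int>"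
      using i j by (intro exI[of _ "(i, j)"]) auto
  qed
  then obtain w where w: "\<And>t. Y (fst (w t)) (snd (w t)) \<notin> \<int>"
    "\<And>t. fst (w (Suc t)) \<noteq> fst (w t)" "\<And>t. snd (w (Suc t)) \<noteq> snd (w t)"
    "\<And>t. Y (fst (w (Suc t))) (snd (w t)) \<notin> \<int>" by blast
  define I J where "I t = fst (w t)" and "J t = snd (w t)" for t
  have "\<not> inj I" using finite_imageD[of I UNIV] by auto
  then have "\<exists>d s. 0 < d \<and> I s = I (s + d)"
    unfolding inj_def by (metis less_imp_add_positive linorder_neqE_nat)
  \<comment> \<open>The period is least over all starting points, which makes \<open>d\<close>
    consecutive rows pairwise distinct. Columns may still repeat.\<close>
  then obtain d where d: "\<exists>s. 0 < d \<and> I s = I (s + d)"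
    "\<And>d'. d' < d \<Longrightarrow> \<not> (\<exists>s. 0 < d' \<and> I s = I (s + d'))"
    using exists_least_iff[of "\<lambda>d. \<exists>s. 0 < d \<and> I s = I (s + d)"] by blast
  then obtain s where s: "0 < d" "I s = I (s + d)" by blast
  have "d \<noteq> 1" using s w(2)[of s] by (auto simp: I_def)
  then have d2: "d \<ge> 2" using s by simp
  have sep: "I t \<noteq> I t'" if "t < t'" "t' - t < d" for t t'
    using d(2)[of "t' - t"] that by (metis le_add_diff_inverse less_imp_le zero_less_diff)
  define G where "G i j = (\<Sum>t\<in>{s..<s+d}. of_bool (I (Suc t) = i \<and> J t = j) - of_bool (I t = i \<and> J t = j) :: real)" for i j
  show thesis
  proof
    fix i
    have "(\<Sum>j\<in>UNIV. G i j) = (\<Sum>t\<in>{s..<s+d}. \<Sum>j\<in>UNIV. of_bool (I (Suc t) = i \<and> J t = j) - of_bool (I t = i \<and> J t = j))"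
      unfolding G_def by (rule sum.swap)
    also have "\<dots> = (\<Sum>t\<in>{s..<s+d}. of_bool (I (Suc t) = i) - of_bool (I t = i))"
      by (intro sum.cong refl) (simp add: sum_subtractf of_bool_conj flip: sum_distrib_left)
    also have "\<dots> = of_bool (I (s + d) = i) - of_bool (I s = i)"
      by (rule sum_Suc_diff') simp
    finally show "(\<Sum>j\<in>UNIV. G i j) = 0" using s by simp
  next
    fix j
    have "(\<Sum>i\<in>UNIV. G i j) = (\<Sum>t\<in>{s..<s+d}. \<Sum>i\<in>UNIV. of_bool (I (Suc t) = i \<and> J t = j) - of_bool (I t = i \<and> J t = j))"
      unfolding G_def by (rule sum.swap)
    also have "\<dots> = 0"
      by (rule sum.neutral, rule ballI) (simp add: sum_subtractf of_bool_conj flip: sum_distrib_right)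
    finally show "(\<Sum>i\<in>UNIV. G i j) = 0" .
  next
    fix i j assume "Y i j \<in> \<int>"
    then show "G i j = 0"
      unfolding G_def using w(1,4) by (intro sum.neutral) (auto simp: I_def J_def)
  next
    \<comment> \<open>Only the indices \<open>s\<close> and \<open>Suc s\<close> touch the row
      \<open>I (Suc s)\<close>, and they do so in the different columns \<open>J s\<close> and
      \<open>J (Suc s)\<close>. So nothing cancels the entry 1 contributed by
      \<open>s\<close>.\<close>
    have zero: "of_bool (I (Suc t) = I (Suc s) \<and> J t = J s) - of_bool (I t = I (Suc s) \<and> J t = J s) = (of_bool (t = s) :: real)"
      if "t \<in> {s..<s+d}" for t
    proof -
      have "I (Suc t) = I (Suc s) \<Longrightarrow> t = s"
      proof (cases "Suc t = s + d")
        case True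
        then show "I (Suc t) = I (Suc s) \<Longrightarrow> t = s" using s sep[of s "Suc s"] d2 by simp
      next
        case False
        then have "t - s < d" "s \<le> t" using that s by auto
        then show "I (Suc t) = I (Suc s) \<Longrightarrow> t = s" using sep[of "Suc s" "Suc t"]
          by (cases "t = s") auto
      qed
      moreover have "t - Suc s < d" using that s by auto
      then have "I t = I (Suc s) \<Longrightarrow> t = Suc s"
        using that sep[of s "Suc s"] sep[of "Suc s" t] d2 by (cases "t = s"; cases "t = Suc s") auto
      moreover have "J (Suc s) \<noteq> J s" using w(3) by (simp add: J_def)
      moreover have "I s \<noteq> I (Suc s)" using w(2)[of s] by (simp add: I_def)
      ultimately show ?thesis by (auto simp: of_bool_def)
    qed
    have "G (I (Suc s)) (J s) = (\<Sum>t\<in>{s..<s+d}. of_bool (t = s))"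
      unfolding G_def by (intro sum.cong zero refl)
    also have "\<dots> = 1" using s by (simp add: of_bool_def)
    finally show "G (I (Suc s)) (J s) \<noteq> 0" by simp
  qed
qed

section \<open>Assignments as vertices and chains of moved items as steps\<close>

definition cnt :: "('n::finite \<Rightarrow> 'k) \<Rightarrow> 'k \<Rightarrow> nat" where
  "cnt f i = card {x. f x = i}"

definition feasible :: "('k \<Rightarrow> nat) \<Rightarrow> ('k \<Rightarrow> nat) \<Rightarrow> ('n::finite \<Rightarrow> 'k) \<Rightarrow> bool" where
  "feasible \<kappa>p \<kappa>m f \<longleftrightarrow> (\<forall>i. \<kappa>m i \<le> cnt f i \<and> cnt f i \<le> \<kappa>p i)"

definition incidence :: "('n::finite \<Rightarrow> 'k::finite) \<Rightarrow> real^('k \<times> 'n)" where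
  "incidence f = (\<chi> p. of_bool (f (snd p) = fst p))"

text \<open>Connectedness of the edges \<open>f x \<rightarrow> f' x\<close>, \<open>x \<in> S\<close>, is expressed by real labellings, because
the row sum constraints in the proof of support-minimality have exactly this form.\<close>

definition linked :: "('n \<Rightarrow> 'k) \<Rightarrow> ('n \<Rightarrow> 'k) \<Rightarrow> 'n set \<Rightarrow> bool" where
  "linked f f' S \<longleftrightarrow> (\<forall>\<beta>::'n \<Rightarrow> real. (\<forall>x\<in>S. \<forall>z\<in>S. f' x = f z \<longrightarrow> \<beta> x = \<beta> z) \<longrightarrow>
     (\<forall>x\<in>S. \<forall>z\<in>S. \<beta> x = \<beta> z))"

text \<open>Injectivity of \<open>f\<close> and \<open>f'\<close> bounds the out- and indegrees by
  one, so a linked \<open>S\<close> is a simple path or a simple cycle of clusters. The loop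
  \<open>f = f'\<close> on a singleton is also a chain; it serves as a trivial step and is excluded
  only in \<open>moves\<close>.\<close>

definition chain :: "('n \<Rightarrow> 'k) \<Rightarrow> ('n \<Rightarrow> 'k) \<Rightarrow> 'n set \<Rightarrow> bool" where
  "chain f f' S \<longleftrightarrow> S \<noteq> {} \<and> inj_on f S \<and> inj_on f' S \<and> (\<forall>x. x \<notin> S \<longrightarrow> f' x = f x) \<and> linked f f' S"

definition moves :: "('k \<Rightarrow> nat) \<Rightarrow> ('k \<Rightarrow> nat) \<Rightarrow> (('n::finite \<Rightarrow> 'k) \<times> ('n \<Rightarrow> 'k)) set" where
  "moves \<kappa>p \<kappa>m = {(f, f'). feasible \<kappa>p \<kappa>m f \<and> feasible \<kappa>p \<kappa>m f' \<and> f \<noteq> f' \<and> (\<exists>S. chain f f' S)}"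

lemma linkedD:
  fixes \<beta> :: "'n \<Rightarrow> real"
  assumes "linked f f' S" "\<And>x z. x \<in> S \<Longrightarrow> z \<in> S \<Longrightarrow> f' x = f z \<Longrightarrow> \<beta> x = \<beta> z" "x \<in> S" "z \<in> S"
  shows "\<beta> x = \<beta> z"
  using assms(1)[unfolded linked_def, rule_format, of \<beta> x z] assms(2-4) by blast

lemma incidence_nth [simp]: "incidence f $ (i, x) = of_bool (f x = i)"
  by (simp add: incidence_def)

lemma sum_incidence_row: "(\<Sum>x\<in>UNIV. incidence f $ (i, x)) = real (cnt f i)"
  by (simp add: of_bool_def sum.If_cases cnt_def)

lemma sum_incidence_column: "(\<Sum>i\<in>UNIV. incidence f $ (i, x)) = 1"
  by (simp add: of_bool_def)

lemma incidence_in_BPP: "incidence f \<in> BPP \<kappa>p \<kappa>m \<longleftrightarrow> feasible \<kappa>p \<kappa>m f"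
  unfolding BPP_def feasible_def mem_Collect_eq sum_incidence_row sum_incidence_column by simp

lemma BPP_nonneg: "y \<in> BPP \<kappa>p \<kappa>m \<Longrightarrow> y $ p \<ge> 0"
  by (cases p) (simp add: BPP_def)

text \<open>A loop at \<open>x\<close> has no other neighbours, so linkedness, tested on the
  indicator of \<open>x\<close>, leaves \<open>S = {x}\<close> and hence
  \<open>f = f'\<close>.\<close>

lemma chain_moves_all:
  assumes "chain f f' S" "f \<noteq> f'" "x \<in> S"
  shows "f' x \<noteq> f x"
proof
  assume eq: "f' x = f x"
  have inj: "inj_on f S" "inj_on f' S" and lk: "linked f f' S" and off: "\<forall>x. x \<notin> S \<longrightarrow> f' x = f x"
    using assms(1) by (auto simp: chain_def)
  have "u = x \<longleftrightarrow> z = x" if "u \<in> S" "z \<in> S" "f' u = f z" for u z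
    using inj eq that \<open>x \<in> S\<close> unfolding inj_on_def by metis
  then have "of_bool (x = x) = (of_bool (z = x) :: real)" if "z \<in> S" for z
    using linkedD[OF lk, of "\<lambda>z. of_bool (z = x)" x z] that \<open>x \<in> S\<close> by auto
  then have "z = x" if "z \<in> S" for z using that by fastforce
  then have "S = {x}" using \<open>x \<in> S\<close> by blast
  then show False using eq off \<open>f \<noteq> f'\<close> by (metis ext singletonD)
qed

lemma card_fiber:
  assumes "inj_on h S"
  shows "card {x\<in>S. h x = i} = of_bool (i \<in> h ` S)"
proof (cases "i \<in> h ` S")
  case True
  then obtain x where "x \<in> S" "h x = i" by blast
  then have "{x\<in>S. h x = i} = {x}" using assms by (auto simp: inj_on_def)
  then show ?thesis using True by simp
next
  case False
  then have "{x\<in>S. h x = i} = {}" by auto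
  then show ?thesis using False by (simp only: card.empty) simp
qed

lemma cnt_chain:
  fixes f :: "'n::finite \<Rightarrow> 'k"
  assumes "inj_on f S" "inj_on f' S" "\<And>x. x \<notin> S \<Longrightarrow> f' x = f x"
  shows "cnt f' i + of_bool (i \<in> f ` S) = cnt f i + of_bool (i \<in> f' ` S)"
proof -
  have *: "cnt h i = of_bool (i \<in> h ` S) + card {x. x \<notin> S \<and> h x = i}" if "inj_on h S"
    for h :: "'n \<Rightarrow> 'k"
  proof -
    have "{x. h x = i} = {x\<in>S. h x = i} \<union> {x. x \<notin> S \<and> h x = i}" by blast
    then have "cnt h i = card {x\<in>S. h x = i} + card {x. x \<notin> S \<and> h x = i}"
      unfolding cnt_def by (metis (no_types, lifting) card_Un_disjoint disjoint_iff finite mem_Collect_eq)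
    then show ?thesis using card_fiber[OF that] by simp
  qed
  have "card {x. x \<notin> S \<and> f x = i} = card {x. x \<notin> S \<and> f' x = i}"
    using assms(3) by (intro arg_cong[of _ _ card]) auto
  then show ?thesis using *[OF assms(1)] *[OF assms(2)] by linarith
qed

text \<open>Let \<open>v\<close> compete with \<open>g\<close> in support. Each column of
  \<open>v\<close> lives on \<open>f x\<close> and \<open>f' x\<close> only, with opposite values
  there. A cluster that is both left and entered keeps its size under \<open>g\<close>, so its row
  sum in \<open>v\<close> also vanishes, which equates the values of consecutive items. By
  linkedness \<open>v\<close> is a multiple of \<open>g\<close>, so its support is not
  smaller.\<close>

lemma incidence_diff_circuit:
  fixes f f' :: "'n::finite \<Rightarrow> 'k::finite"
  assumes ch: "chain f f' S" and "f \<noteq> f'"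
  shows "incidence f' - incidence f \<in> circuits bpp_A bpp_B"
proof -
  define g where "g = incidence f' - incidence f"
  have gn: "g $ (i, x) = of_bool (f' x = i) - of_bool (f x = i)" for i x
    by (simp add: g_def)
  have inj: "inj_on f S" "inj_on f' S" and lk: "linked f f' S" and off: "\<And>x. x \<notin> S \<Longrightarrow> f' x = f x"
    and "S \<noteq> {}" using ch by (auto simp: chain_def)
  have mv: "\<And>x. x \<in> S \<Longrightarrow> f' x \<noteq> f x" using chain_moves_all[OF assms] by blast
  obtain x0 where x0: "x0 \<in> S" using \<open>S \<noteq> {}\<close> by blast
  have "bpp_A *v g = 0"
    by (simp add: vec_eq_iff bpp_A_mult g_def sum_subtractf of_bool_def)
  moreover have "g \<noteq> 0"
    using gn[of "f x0" x0] mv[OF x0] by auto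
  moreover have "coprime_integral g"
    unfolding coprime_integral_def
  proof (intro exI conjI allI)
    let ?z = "\<lambda>p. of_bool (f' (snd p) = fst p) - of_bool (f (snd p) = fst p) :: int"
    show "g $ p = of_int (?z p)" for p by (cases p) (simp add: gn)
    have "?z (f' x0, x0) = 1" using mv[OF x0] by auto
    then have "1 \<in> range ?z" using rangeI[of ?z "(f' x0, x0)"] by simp
    then show "Gcd (range ?z) = 1" by (rule Gcd_eq_1_I[rotated]) simp
  qed
  moreover have "\<not> (\<exists>x. bpp_A *v x = 0 \<and> x \<noteq> 0 \<and> supp (bpp_B *v x) \<subset> supp (bpp_B *v g))"
  proof
    assume "\<exists>x. bpp_A *v x = 0 \<and> x \<noteq> 0 \<and> supp (bpp_B *v x) \<subset> supp (bpp_B *v g)"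
    then obtain v :: "real^('k \<times> 'n)" where v: "bpp_A *v v = 0" "v \<noteq> 0"
      "supp (bpp_B *v v) \<subseteq> supp (bpp_B *v g)" "supp (bpp_B *v v) \<noteq> supp (bpp_B *v g)" by blast
    have sub: "(bpp_B *v g) $ c = 0 \<Longrightarrow> (bpp_B *v v) $ c = 0" for c
      using v(3) by (auto simp: supp_def)
    have col: "(\<Sum>i\<in>UNIV. v $ (i, x)) = 0" for x
      using v(1) by (metis bpp_A_mult zero_index)
    have entry: "v $ (i, x) = 0" if "g $ (i, x) = 0" for i x
      using sub[of "Inr (i, x)"] that by (simp add: bpp_B_mult)
    have off0: "v $ (i, x) = 0" if "x \<notin> S \<or> i \<noteq> f x \<and> i \<noteq> f' x" for i x
      using that off by (intro entry) (auto simp: gn)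
    have anti: "v $ (f x, x) = - v $ (f' x, x)" if "x \<in> S" for x
    proof -
      have "(\<Sum>i\<in>UNIV. v $ (i, x)) = (\<Sum>i\<in>{f x, f' x}. v $ (i, x))"
        using off0 by (intro sum.mono_neutral_right) auto
      then show ?thesis using col[of x] mv[OF that] by simp
    qed
    have next_eq: "v $ (f' x, x) = v $ (f' z, z)" if xz: "x \<in> S" "z \<in> S" "f' x = f z" for x z
    proof -
      have "x \<noteq> z" using xz mv by metis
      have "(\<Sum>y\<in>UNIV. g $ (f z, y)) = real (cnt f' (f z)) - real (cnt f (f z))"
        by (simp only: g_def vector_minus_component sum_subtractf sum_incidence_row)
      moreover have "f z \<in> f ` S" "f z \<in> f' ` S" using xz by (blast, metis imageI)
      then have "cnt f' (f z) = cnt f (f z)"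
        using cnt_chain[of f S f' "f z"] inj off by simp
      ultimately have "(\<Sum>y\<in>UNIV. g $ (f z, y)) = 0" by simp
      then have "0 = (\<Sum>y\<in>UNIV. v $ (f z, y))"
        using sub[of "Inl (Inl (f z))"] by (simp add: bpp_B_mult)
      also have "\<dots> = (\<Sum>y\<in>{x, z}. v $ (f z, y))"
      proof (intro sum.mono_neutral_right ballI)
        fix y assume y: "y \<in> UNIV - {x, z}"
        show "v $ (f z, y) = 0"
          using y xz inj by (intro off0) (metis DiffD2 inj_onD insertCI)
      qed auto
      also have "\<dots> = v $ (f' x, x) - v $ (f' z, z)"
        using \<open>x \<noteq> z\<close> anti[OF xz(2)] xz(3) by simp
      finally show ?thesis by simp
    qed
    have const: "v $ (f' x, x) = v $ (f' z, z)" if "x \<in> S" "z \<in> S" for x z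
      using linkedD[OF lk, of "\<lambda>x. v $ (f' x, x)"] next_eq that by blast
    define b where "b = v $ (f' x0, x0)"
    have "v $ (i, x) = b * g $ (i, x)" for i x
    proof (cases "x \<in> S \<and> (i = f x \<or> i = f' x)")
      case True
      then show ?thesis using const[of x x0] x0 anti[of x] mv[of x] by (auto simp: gn b_def)
    next
      case False
      then show ?thesis using off0[of x i] off[of x] by (auto simp: gn)
    qed
    then have vg: "v = b *\<^sub>R g" by (simp add: vec_eq_iff split_paired_all)
    then have "b \<noteq> 0" using v(2) by auto
    then have "supp (bpp_B *v v) = supp (bpp_B *v g)"
      unfolding vg by (simp add: supp_def matrix_vector_mult_scaleR)
    then show False using v(4) by contradiction
  qed
  ultimately show ?thesis unfolding circuits_def g_def by blast
qed

text \<open>Every move is a step of length 1 between vertices. The length is maximal because the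
  entry of a moved item in its old cluster drops from 1 to 0 and would become negative beyond
  that.\<close>

lemma circuit_distance_le:
  fixes f g :: "'n::finite \<Rightarrow> 'k::finite"
  assumes "(f, g) \<in> moves \<kappa>p \<kappa>m ^^ m" and "feasible \<kappa>p \<kappa>m f"
  shows "circuit_distance bpp_A bpp_b bpp_B (bpp_d \<kappa>p \<kappa>m) (incidence f) (incidence g) \<le> enat m"
proof -
  obtain w where w: "w 0 = f" "w m = g" "\<And>r. r < m \<Longrightarrow> (w r, w (Suc r)) \<in> moves \<kappa>p \<kappa>m"
    using assms(1) unfolding relpow_fun_conv by blast
  have feas: "feasible \<kappa>p \<kappa>m (w r)" if "r \<le> m" for r
    using that assms(2) w(1) w(3)[of "r - 1"] by (cases r) (auto simp: moves_def)
  have "circuit_walk bpp_A bpp_b bpp_B (bpp_d \<kappa>p \<kappa>m) m (\<lambda>r. incidence (w r))"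
    unfolding circuit_walk_def BPP_eq_polyhedron_of[symmetric] incidence_in_BPP
  proof (intro conjI allI impI)
    fix r assume "r \<le> m"
    then show "feasible \<kappa>p \<kappa>m (w r)" by (rule feas)
  next
    fix r assume "r < m"
    then obtain S where S: "chain (w r) (w (Suc r)) S" "w r \<noteq> w (Suc r)"
      using w(3) by (auto simp: moves_def)
    then obtain x where x: "x \<in> S" by (auto simp: chain_def)
    let ?g = "incidence (w (Suc r)) - incidence (w r)"
    have neg: "(incidence (w r) + \<beta> *\<^sub>R ?g) $ (w r x, x) < 0" if "\<beta> > 1" for \<beta> :: real
      using chain_moves_all[OF S x] that by simp
    have "incidence (w r) + \<beta> *\<^sub>R ?g \<notin> BPP \<kappa>p \<kappa>m" if "\<beta> > 1" for \<beta> :: real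
      using neg[OF that] BPP_nonneg not_le by blast
    then show "\<exists>g\<in>circuits bpp_A bpp_B. \<exists>\<alpha>>0.
        incidence (w (Suc r)) - incidence (w r) = \<alpha> *\<^sub>R g \<and>
        (\<forall>\<beta>>\<alpha>. incidence (w r) + \<beta> *\<^sub>R g \<notin> BPP \<kappa>p \<kappa>m)"
      using incidence_diff_circuit[OF S] by (intro bexI[of _ ?g] exI[of _ 1]) auto
  qed
  then show ?thesis
    unfolding circuit_distance_def using w(1,2) by (intro Inf_lower) blast
qed

text \<open>A nonintegral point can be shifted in two opposite directions along a cycle of
  nonintegral entries, so it is not extreme. An integral point has exactly one entry 1 per
  column.\<close>

lemma extreme_point_incidence:
  fixes y :: "real^('k::finite \<times> 'n::finite)"
  assumes ext: "y extreme_point_of BPP \<kappa>p \<kappa>m"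
  obtains f where "y = incidence f" "feasible \<kappa>p \<kappa>m f"
proof -
  have yB: "y \<in> BPP \<kappa>p \<kappa>m" using ext by (simp add: extreme_point_of_def)
  then have col: "\<And>x. (\<Sum>i\<in>UNIV. y $ (i, x)) = 1" and pos: "\<And>i x. y $ (i, x) \<ge> 0"
    and lo: "\<And>i. (\<Sum>x\<in>UNIV. y $ (i, x)) \<ge> real (\<kappa>m i)"
    and hi: "\<And>i. (\<Sum>x\<in>UNIV. y $ (i, x)) \<le> real (\<kappa>p i)"
    by (auto simp: BPP_def)
  define R where "R i = (\<Sum>x\<in>UNIV. y $ (i, x))" for i
  have int: "y $ (i, x) \<in> \<int>" for i x
  proof (rule ccontr)
    assume frac: "y $ (i, x) \<notin> \<int>"
    \<comment> \<open>The additional column \<open>None\<close> makes all row sums integral; it is nonintegral only where the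
      size constraints of the cluster are slack.\<close>
    define Y where "Y i q = (case q of None \<Rightarrow> - R i | Some x \<Rightarrow> y $ (i, x))" for i q
    have sum_opt: "(\<Sum>q\<in>UNIV. u q) = u None + (\<Sum>x\<in>UNIV. u (Some x))" for u :: "'n option \<Rightarrow> real"
      by (simp add: UNIV_option_conv sum.reindex)
    have "(\<Sum>i\<in>UNIV. R i) = (\<Sum>x\<in>(UNIV :: 'n set). 1)"
      unfolding R_def by (subst sum.swap) (simp add: col)
    then have "(\<Sum>i\<in>UNIV. R i) \<in> \<int>" by simp
    then have cols: "(\<Sum>i\<in>UNIV. Y i q) \<in> \<int>" for q
      by (cases q) (simp_all add: Y_def sum_negf col)
    have rows: "(\<Sum>q\<in>UNIV. Y i q) \<in> \<int>" for i by (simp add: sum_opt Y_def R_def)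
    have "Y i (Some x) \<notin> \<int>" using frac by (simp add: Y_def)
    with rows cols obtain G i' q' where G: "\<And>i. (\<Sum>q\<in>UNIV. G i q) = 0" "\<And>q. (\<Sum>i\<in>UNIV. G i q) = 0"
      "\<And>i q. Y i q \<in> \<int> \<Longrightarrow> G i q = 0" "G i' q' \<noteq> (0::real)"
      by (rule noninteger_cycle[of Y i "Some x"]) blast
    define g :: "real^('k \<times> 'n)" where "g = (\<chi> p. G (fst p) (Some (snd p)))"
    have g: "g $ (i, x) = G i (Some x)" for i x by (simp add: g_def)
    have rowg: "(\<Sum>x\<in>UNIV. g $ (i, x)) = - G i None" for i
      using G(1)[of i] by (simp add: sum_opt g)
    have "g \<noteq> 0"
    proof
      assume "g = 0"
      then have "G i (Some x) = 0" for i x using g by (metis zero_index)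
      then show False using G(4) rowg[of i'] \<open>g = 0\<close> by (cases q') auto
    qed
    \<comment> \<open>Only strict constraints are affected: \<open>g\<close> lives on nonintegral,
      hence positive, entries, and it changes only nonintegral row sums, which differ from the
      integral size bounds. The filter \<open>at 0\<close> covers both signs of
      \<open>t\<close>.\<close>
    have ev: "\<forall>\<^sub>F t in at 0. y + t *\<^sub>R g \<in> BPP \<kappa>p \<kappa>m"
    proof -
      have 1: "\<forall>\<^sub>F t in at 0. \<forall>p. y $ p + t * g $ p \<ge> 0"
      proof (intro eventually_all_finite)
        fix p :: "'k \<times> 'n"
        obtain i x where p: "p = (i, x)" by (cases p)
        show "\<forall>\<^sub>F t in at 0. y $ p + t * g $ p \<ge> 0"
        proof (cases "y $ p \<in> \<int>")
          case True
          then have "g $ p = 0" using G(3)[of i "Some x"] by (simp add: p g Y_def)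
          then show ?thesis using pos by (simp add: p)
        next
          case False
          then have "y $ p > 0" using pos[of i x] by (auto simp: p less_le)
          moreover have "((\<lambda>t. y $ p + t * g $ p) \<longlongrightarrow> y $ p + 0 * g $ p) (at 0)"
            by (intro tendsto_intros)
          ultimately have "\<forall>\<^sub>F t in at 0. y $ p + t * g $ p > 0"
            using order_tendstoD(1)[of _ "y $ p" "at 0" 0] by simp
          then show ?thesis by (rule eventually_mono) simp
        qed
      qed
      have 2: "\<forall>\<^sub>F t in at 0. \<forall>i. real (\<kappa>m i) \<le> R i - t * G i None \<and> R i - t * G i None \<le> real (\<kappa>p i)"
      proof (intro eventually_all_finite)
        fix i
        show "\<forall>\<^sub>F t in at 0. real (\<kappa>m i) \<le> R i - t * G i None \<and> R i - t * G i None \<le> real (\<kappa>p i)"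
        proof (cases "R i \<in> \<int>")
          case True
          then have "G i None = 0" using G(3)[of i None] by (simp add: Y_def)
          then show ?thesis using lo hi by (simp add: R_def)
        next
          case False
          have "R i \<noteq> real (\<kappa>m i)" "R i \<noteq> real (\<kappa>p i)" using False by (metis Ints_of_nat)+
          then have b: "real (\<kappa>m i) < R i" "R i < real (\<kappa>p i)" using lo[of i] hi[of i] by (auto simp: R_def)
          have lim: "((\<lambda>t. R i - t * G i None) \<longlongrightarrow> R i - 0 * G i None) (at 0)"
            by (intro tendsto_intros)
          have "\<forall>\<^sub>F t in at 0. real (\<kappa>m i) < R i - t * G i None"
            "\<forall>\<^sub>F t in at 0. R i - t * G i None < real (\<kappa>p i)"
            using order_tendstoD[OF lim] b by auto
          then show ?thesis by eventually_elim simp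
        qed
      qed
      show ?thesis using 1 2
      proof eventually_elim
        case (elim t)
        have "(\<Sum>i\<in>UNIV. (y + t *\<^sub>R g) $ (i, x)) = 1" for x
          using G(2) col by (simp add: sum.distrib g flip: sum_distrib_left)
        moreover have "(\<Sum>x\<in>UNIV. (y + t *\<^sub>R g) $ (i, x)) = R i - t * G i None" for i
          by (simp add: sum.distrib R_def rowg flip: sum_distrib_left)
        ultimately show ?case using elim by (simp add: BPP_def)
      qed
    qed
    then obtain e where e: "e > 0" "\<And>t. t \<noteq> 0 \<Longrightarrow> dist t 0 < e \<Longrightarrow> y + t *\<^sub>R g \<in> BPP \<kappa>p \<kappa>m"
      unfolding eventually_at by blast
    have in2: "y + (e/2) *\<^sub>R g \<in> BPP \<kappa>p \<kappa>m" "y + (- e/2) *\<^sub>R g \<in> BPP \<kappa>p \<kappa>m"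
      using e(1) e(2)[of "e/2"] e(2)[of "- e/2"] by auto
    have "y = midpoint (y + (e/2) *\<^sub>R g) (y + (- e/2) *\<^sub>R g)"
      by (simp add: midpoint_def scaleR_add_right flip: scaleR_add_left)
    moreover have "(e/2) *\<^sub>R g \<noteq> (- e/2) *\<^sub>R g"
      using \<open>g \<noteq> 0\<close> e(1) unfolding scaleR_cancel_right by auto
    then have "y + (e/2) *\<^sub>R g \<noteq> y + (- e/2) *\<^sub>R g" by (simp only: add_left_cancel not_False_eq_True)
    ultimately have "y \<in> open_segment (y + (e/2) *\<^sub>R g) (y + (- e/2) *\<^sub>R g)"
      by (metis midpoint_in_open_segment)
    then show False using ext in2 by (simp add: extreme_point_of_def)
  qed
  have "\<exists>i. y $ (i, x) = 1 \<and> (\<forall>i'. i' \<noteq> i \<longrightarrow> y $ (i', x) = 0)" for x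
  proof -
    have "\<exists>i. y $ (i, x) \<noteq> 0" using col[of x] by (metis sum.neutral zero_neq_one)
    then obtain i where i: "y $ (i, x) \<noteq> 0" by blast
    have "y $ (i, x) \<ge> 1" using i pos[of i x] int[of i x] by (auto elim!: Ints_cases)
    moreover have "1 = y $ (i, x) + (\<Sum>i'\<in>UNIV - {i}. y $ (i', x))"
      using col[of x] by (simp add: sum.remove[of UNIV i])
    moreover have "(\<Sum>i'\<in>UNIV - {i}. y $ (i', x)) \<ge> 0" using pos by (intro sum_nonneg) auto
    ultimately have "y $ (i, x) = 1" "(\<Sum>i'\<in>UNIV - {i}. y $ (i', x)) = 0" by linarith+
    then show ?thesis using pos by (subst (asm) sum_nonneg_eq_0_iff) auto
  qed
  then obtain f where f: "\<And>x. y $ (f x, x) = 1" "\<And>x i. i \<noteq> f x \<Longrightarrow> y $ (i, x) = 0" by metis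
  have "y = incidence f"
    using f by (auto simp: vec_eq_iff split_paired_all of_bool_def)
  then show thesis using that yB incidence_in_BPP by metis
qed

subsection \<open>Realising a cover in two steps\<close>

text \<open>The outdegree of \<open>i\<close> in the graph of edges
  \<open>f x \<rightarrow> g x\<close>; \<open>leaving g f i\<close> is its indegree.\<close>

definition leaving :: "('n::finite \<Rightarrow> 'k) \<Rightarrow> ('n \<Rightarrow> 'k) \<Rightarrow> 'k \<Rightarrow> nat" where
  "leaving f g i = card {x. f x = i \<and> g x \<noteq> i}"

text \<open>The total surplus \<open>H\<close>. Truncated subtraction restricts the sum to the
  clusters that have to shrink.\<close>

definition excess :: "('n::finite \<Rightarrow> 'k::finite) \<Rightarrow> ('n \<Rightarrow> 'k) \<Rightarrow> nat" where
  "excess f g = (\<Sum>i\<in>UNIV. leaving f g i - leaving g f i)"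

text \<open>The edges of vertex-disjoint cycles and paths, where each path starts in a cluster that
  has to shrink and ends in one that has to grow.\<close>

definition exchange :: "('n::finite \<Rightarrow> 'k) \<Rightarrow> ('n \<Rightarrow> 'k) \<Rightarrow> 'n set \<Rightarrow> bool" where
  "exchange f g M \<longleftrightarrow> inj_on f M \<and> inj_on g M \<and> (\<forall>x\<in>M. f x \<noteq> g x) \<and>
     (\<forall>i\<in>f ` M - g ` M. leaving g f i < leaving f g i) \<and>
     (\<forall>i\<in>g ` M - f ` M. leaving f g i < leaving g f i)"

text \<open>A union of connected components of \<open>M\<close>.\<close>

definition closed_part :: "('n \<Rightarrow> 'k) \<Rightarrow> ('n \<Rightarrow> 'k) \<Rightarrow> 'n set \<Rightarrow> 'n set \<Rightarrow> bool" where
  "closed_part f g M C \<longleftrightarrow> C \<subseteq> M \<and> (\<forall>x\<in>M. \<forall>z\<in>M. g x = f z \<longrightarrow> (x \<in> C \<longleftrightarrow> z \<in> C))"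

definition two_step :: "('n \<Rightarrow> 'k) \<Rightarrow> ('n \<Rightarrow> 'k) \<Rightarrow> 'n set \<Rightarrow> 'n set \<Rightarrow> bool" where
  "two_step f g M N \<longleftrightarrow> (\<exists>f1 S T y. chain f f1 S \<and> chain f1 (override_on f g N) T \<and>
     y \<in> S \<and> y \<in> T \<and> S \<subseteq> N \<and> T \<subseteq> N \<and> f1 ` N \<subseteq> f ` N \<union> g ` N \<and>
     f ` S - f1 ` S \<subseteq> f ` M - g ` M \<and> f1 ` S - f ` S \<subseteq> g ` M - f ` M)"

lemma two_stepI:
  assumes "chain f f1 S" "chain f1 (override_on f g N) T"
    "f1 ` N \<subseteq> f ` N \<union> g ` N" "f ` S - f1 ` S \<subseteq> f ` M - g ` M" "f1 ` S - f ` S \<subseteq> g ` M - f ` M"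
    "y \<in> S" "y \<in> T" "S \<subseteq> N" "T \<subseteq> N"
  shows "two_step f g M N"
  unfolding two_step_def
  by (intro exI[of _ f1] exI[of _ S] exI[of _ T] exI[of _ y] conjI assms)

text \<open>An upper bound on the number of moves, since a chain may turn out to be trivial.\<close>

definition reach ::
  "('k \<Rightarrow> nat) \<Rightarrow> ('k \<Rightarrow> nat) \<Rightarrow> nat \<Rightarrow> ('n::finite \<Rightarrow> 'k) \<Rightarrow> ('n \<Rightarrow> 'k) \<Rightarrow> bool" where
  "reach \<kappa>p \<kappa>m n f g \<longleftrightarrow> (\<exists>m\<le>n. (f, g) \<in> moves \<kappa>p \<kappa>m ^^ m)"

section \<open>Degrees and surplus under an exchange\<close>

lemma leaving_le_cnt: "leaving f g i \<le> cnt f i"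
  unfolding leaving_def cnt_def by (intro card_mono) auto

lemma cnt_leaving: "cnt f i + leaving g f i = cnt g i + leaving f g i"
proof -
  have *: "cnt f i = card {x. f x = i \<and> g x = i} + leaving f g i" for f g :: "'a \<Rightarrow> 'b"
  proof -
    have "{x. f x = i} = {x. f x = i \<and> g x = i} \<union> {x. f x = i \<and> g x \<noteq> i}" by blast
    then show ?thesis unfolding cnt_def leaving_def
      by (metis (no_types, lifting) card_Un_disjoint disjoint_iff finite mem_Collect_eq)
  qed
  show ?thesis using *[of f g] *[of g f] by (simp add: conj_commute)
qed

lemma sum_leaving: "(\<Sum>i\<in>UNIV. leaving f g i) = card {x. f x \<noteq> g x}"
  for f g :: "'n::finite \<Rightarrow> 'k::finite"
proof -
  have "(\<Sum>i\<in>UNIV. leaving f g i) = card (\<Union>i. {x. f x = i \<and> g x \<noteq> i})"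
    unfolding leaving_def by (rule card_UN_disjoint[symmetric]) auto
  also have "(\<Union>i. {x. f x = i \<and> g x \<noteq> i}) = {x. f x \<noteq> g x}" by force
  finally show ?thesis .
qed

text \<open>Outdegrees and indegrees both add up to the number of items to be moved, so total
  surplus and total deficit agree.\<close>

lemma excess_commute: "excess f g = excess g f"
proof -
  have "(\<Sum>i\<in>UNIV. leaving f g i) = (\<Sum>i\<in>UNIV. leaving g f i)"
    by (simp add: sum_leaving) metis
  moreover have "excess f g + (\<Sum>i\<in>UNIV. leaving g f i) = excess g f + (\<Sum>i\<in>UNIV. leaving f g i)"
    unfolding excess_def sum.distrib[symmetric] by (intro sum.cong) auto
  ultimately show ?thesis by simp
qed

lemma leaving_eq_sum: "leaving f g i = (\<Sum>j\<in>UNIV - {i}. card {x. f x = i \<and> g x = j})"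
  for f g :: "'n::finite \<Rightarrow> 'k::finite"
proof -
  have "{x. f x = i \<and> g x \<noteq> i} = (\<Union>j\<in>UNIV - {i}. {x. f x = i \<and> g x = j})" by auto
  then show ?thesis
    unfolding leaving_def by (simp only:) (rule card_UN_disjoint, auto)
qed

text \<open>The items of \<open>M\<close> reach their destinations, so their edges disappear, and by
  injectivity at most one disappears on each side of a cluster.\<close>

lemma leaving_exchange:
  fixes f g :: "'n::finite \<Rightarrow> 'k"
  assumes "exchange f g M"
  shows "leaving (override_on f g M) g i + of_bool (i \<in> f ` M) = leaving f g i"
    and "leaving g (override_on f g M) i + of_bool (i \<in> g ` M) = leaving g f i"
proof -
  have inj: "inj_on f M" "inj_on g M" and ne: "\<And>x. x \<in> M \<Longrightarrow> f x \<noteq> g x"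
    using assms by (auto simp: exchange_def)
  have "x \<in> {x. f x = i \<and> g x \<noteq> i} \<longleftrightarrow>
      x \<in> {x. override_on f g M x = i \<and> g x \<noteq> i} \<union> {x\<in>M. f x = i}" for x
    using ne[of x] by (cases "x \<in> M") auto
  then have "{x. f x = i \<and> g x \<noteq> i} = {x. override_on f g M x = i \<and> g x \<noteq> i} \<union> {x\<in>M. f x = i}"
    by (rule set_eqI)
  moreover have "{x. override_on f g M x = i \<and> g x \<noteq> i} \<inter> {x\<in>M. f x = i} = {}"
    by (auto simp: override_on_def)
  ultimately show "leaving (override_on f g M) g i + of_bool (i \<in> f ` M) = leaving f g i"
    unfolding leaving_def card_fiber[OF inj(1), symmetric] by (simp only: card_Un_disjoint finite)
  have "x \<in> {x. g x = i \<and> f x \<noteq> i} \<longleftrightarrow>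
      x \<in> {x. g x = i \<and> override_on f g M x \<noteq> i} \<union> {x\<in>M. g x = i}" for x
    using ne[of x] by (cases "x \<in> M") auto
  then have "{x. g x = i \<and> f x \<noteq> i} = {x. g x = i \<and> override_on f g M x \<noteq> i} \<union> {x\<in>M. g x = i}"
    by (rule set_eqI)
  moreover have "{x. g x = i \<and> override_on f g M x \<noteq> i} \<inter> {x\<in>M. g x = i} = {}"
    by (auto simp: override_on_def)
  ultimately show "leaving g (override_on f g M) i + of_bool (i \<in> g ` M) = leaving g f i"
    unfolding leaving_def card_fiber[OF inj(2), symmetric] by (simp only: card_Un_disjoint finite)
qed

text \<open>The surplus drops by one at the start of each path. The strict inequalities in
  \<open>exchange\<close> ensure that truncation hides nothing there and that the end of a path does
  not acquire a surplus.\<close>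

lemma excess_exchange:
  fixes f g :: "'n::finite \<Rightarrow> 'k::finite"
  assumes "exchange f g M"
  shows "excess (override_on f g M) g + card (f ` M - g ` M) = excess f g"
proof -
  let ?h = "override_on f g M"
  have "card (f ` M - g ` M) = (\<Sum>i\<in>UNIV. of_bool (i \<in> f ` M - g ` M))"
    by (simp add: sum.If_cases of_bool_def set_diff_eq)
  then have "excess ?h g + card (f ` M - g ` M)
      = (\<Sum>i\<in>UNIV. (leaving ?h g i - leaving g ?h i) + of_bool (i \<in> f ` M - g ` M))"
    by (simp add: excess_def sum.distrib)
  also have "\<dots> = excess f g"
    unfolding excess_def
  proof (intro sum.cong refl)
    fix i
    note l = leaving_exchange[OF assms, of i]
    have "i \<in> f ` M - g ` M \<Longrightarrow> leaving g f i < leaving f g i"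
      "i \<in> g ` M - f ` M \<Longrightarrow> leaving f g i < leaving g f i"
      using assms by (auto simp: exchange_def)
    then show "leaving ?h g i - leaving g ?h i + of_bool (i \<in> f ` M - g ` M)
        = leaving f g i - leaving g f i"
      using l by (cases "i \<in> f ` M"; cases "i \<in> g ` M") auto
  qed
  finally show ?thesis .
qed

text \<open>Edges that meet in a cluster lie in the same components, so path ends within
  \<open>C\<close> are already path ends within \<open>M\<close>.\<close>

lemma closed_part_diff:
  assumes "closed_part f g M C"
  shows "f ` C - g ` C \<subseteq> f ` M - g ` M" "g ` C - f ` C \<subseteq> g ` M - f ` M"
proof -
  have C: "C \<subseteq> M" "\<And>x z. x \<in> M \<Longrightarrow> z \<in> M \<Longrightarrow> g x = f z \<Longrightarrow> x \<in> C \<longleftrightarrow> z \<in> C"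
    using assms by (auto simp: closed_part_def)
  show "f ` C - g ` C \<subseteq> f ` M - g ` M"
  proof
    fix i assume "i \<in> f ` C - g ` C"
    then obtain x where x: "x \<in> C" "i = f x" "f x \<notin> g ` C" by blast
    have "f x \<notin> g ` M"
    proof
      assume "f x \<in> g ` M"
      then obtain u where eq: "f x = g u" and that: "u \<in> M" by (rule imageE)
      then have "u \<in> C" using C(2)[OF that subsetD[OF C(1) x(1)]] x(1) by metis
      then show False using x(3) eq by simp
    qed
    then show "i \<in> f ` M - g ` M" using x(1,2) C(1) by auto
  qed
  show "g ` C - f ` C \<subseteq> g ` M - f ` M"
  proof
    fix i assume "i \<in> g ` C - f ` C"
    then obtain x where x: "x \<in> C" "i = g x" "g x \<notin> f ` C" by blast
    have "g x \<notin> f ` M"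
    proof
      assume "g x \<in> f ` M"
      then obtain u where eq: "g x = f u" and that: "u \<in> M" by (rule imageE)
      then have "u \<in> C" using C(2)[OF subsetD[OF C(1) x(1)] that] x(1) by metis
      then show False using x(3) eq by simp
    qed
    then show "i \<in> g ` M - f ` M" using x(1,2) C(1) by auto
  qed
qed

lemma exchange_closed_part:
  assumes "exchange f g M" "closed_part f g M C"
  shows "exchange f g C"
proof -
  have CM: "C \<subseteq> M" using assms(2) by (simp add: closed_part_def)
  have "inj_on f M" "inj_on g M" using assms(1) by (auto simp: exchange_def)
  then have "inj_on f C" "inj_on g C" using inj_on_subset CM by auto
  then show ?thesis
    using assms(1) closed_part_diff[OF assms(2)] CM unfolding exchange_def by blast
qed

text \<open>The last property expresses minimality; it provides disjointness from components treated
  earlier.\<close>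

lemma component:
  assumes "x \<in> M"
  obtains C where "x \<in> C" "closed_part f g M C" "linked f g C"
    "\<And>N. closed_part f g M N \<Longrightarrow> x \<notin> N \<Longrightarrow> C \<inter> N = {}"
proof
  define E where "E = {(u, v). u \<in> M \<and> v \<in> M \<and> (g u = f v \<or> g v = f u)}"
  let ?C = "{z. (x, z) \<in> E\<^sup>*}"
  show "x \<in> ?C" by simp
  have CM: "?C \<subseteq> M"
  proof
    fix z assume "z \<in> ?C"
    then have "(x, z) \<in> E\<^sup>*" by simp
    then show "z \<in> M" by (induction rule: rtrancl_induct) (use assms in \<open>auto simp: E_def\<close>)
  qed
  then show "closed_part f g M ?C"
    unfolding closed_part_def by (auto simp: E_def intro: rtrancl_into_rtrancl)
  show "linked f g ?C"
    unfolding linked_def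
  proof (intro allI impI)
    fix \<beta> :: "'a \<Rightarrow> real"
    assume b: "\<forall>u\<in>?C. \<forall>v\<in>?C. g u = f v \<longrightarrow> \<beta> u = \<beta> v"
    have root: "\<beta> z = \<beta> x" if "z \<in> ?C" for z
    proof -
      have "(x, z) \<in> E\<^sup>*" using that by simp
      then show ?thesis
      proof (induction rule: rtrancl_induct)
        case (step u v)
        then have "u \<in> ?C" "v \<in> ?C" "g u = f v \<or> g v = f u"
          by (auto simp: E_def intro: rtrancl_into_rtrancl)
        then show ?case using b step.IH by metis
      qed simp
    qed
    show "\<forall>u\<in>?C. \<forall>v\<in>?C. \<beta> u = \<beta> v"
      by (intro ballI) (rule trans[OF root root[symmetric]])
  qed
  fix N assume N: "closed_part f g M N" "x \<notin> N"
  have "z \<notin> N" if "(x, z) \<in> E\<^sup>*" for z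
    using that
  proof (induction rule: rtrancl_induct)
    case (step u v)
    then show ?case using N(1) unfolding closed_part_def E_def by blast
  qed (rule N(2))
  then show "?C \<inter> N = {}" by auto
qed

text \<open>A cycle stays connected when the link from \<open>l\<close> to its successor is cut. The
  set \<open>U\<close> where \<open>\<beta>\<close> differs from \<open>\<beta> l\<close> avoids
  \<open>l\<close>, hence is closed under successors, and by counting also under predecessors. So
  the successor of \<open>l\<close> is not in \<open>U\<close>.\<close>

lemma linked_cut:
  fixes \<beta> :: "'n::finite \<Rightarrow> real"
  assumes lk: "linked f g L" and inj: "inj_on f L" "inj_on g L" and img: "f ` L = g ` L"
    and "l \<in> L" and \<beta>: "\<And>x z. x \<in> L - {l} \<Longrightarrow> z \<in> L \<Longrightarrow> g x = f z \<Longrightarrow> \<beta> x = \<beta> z"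
    and "x \<in> L" "z \<in> L"
  shows "\<beta> x = \<beta> z"
proof (rule linkedD[OF lk _ \<open>x \<in> L\<close> \<open>z \<in> L\<close>])
  fix x z assume xz: "x \<in> L" "z \<in> L" "g x = f z"
  define U where "U = {u\<in>L. \<beta> u \<noteq> \<beta> l}"
  have "g ` U \<subseteq> f ` U"
  proof
    fix i assume "i \<in> g ` U"
    then obtain u where u: "u \<in> U" "i = g u" by blast
    then obtain v where v: "v \<in> L" "g u = f v" using img by (auto simp: U_def)
    have "u \<in> L - {l}" using u by (auto simp: U_def)
    then have "\<beta> u = \<beta> v" using \<beta> v by blast
    then have "v \<in> U" using u v by (simp add: U_def)
    then show "i \<in> f ` U" using u v by blast
  qed
  moreover have "inj_on f U" "inj_on g U" using inj by (auto simp: U_def inj_on_def)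
  ultimately have "g ` U = f ` U" by (intro card_subset_eq) (auto simp: card_image)
  have "x \<in> U" if "z \<in> U"
  proof -
    have "f z \<in> g ` U" unfolding \<open>g ` U = f ` U\<close> using that by simp
    then obtain u where u: "u \<in> U" "g x = g u" using xz(3) by auto
    then have "x = u" using inj_onD[OF inj(2) u(2) xz(1)] by (simp add: U_def)
    then show ?thesis using u by simp
  qed
  then have "\<beta> z = \<beta> l" if "x = l" using that xz(2) by (auto simp: U_def)
  then show "\<beta> x = \<beta> z" using \<beta>[of x z] xz by (cases "x = l") simp_all
qed

text \<open>One step suffices here; the second chain is a trivial loop at \<open>y\<close>.\<close>

lemma two_step_component:
  assumes "C \<noteq> {}" "exchange f g M" "closed_part f g M C" "linked f g C"
  shows "two_step f g M C"
proof -
  obtain y where y: "y \<in> C" using assms(1) by blast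
  let ?h = "override_on f g C"
  have inj: "inj_on f C" "inj_on g C" using exchange_closed_part[OF assms(2,3)] by (auto simp: exchange_def)
  have img: "?h ` C = g ` C" by (auto simp: override_on_def)
  have "inj_on ?h C" using inj by (auto simp: inj_on_def override_on_def)
  moreover have "linked f ?h C" using assms(4) by (simp add: linked_def override_on_def)
  ultimately have "chain f ?h C" using assms(1) inj by (simp add: chain_def override_on_def)
  moreover have "chain ?h ?h {y}" by (simp add: chain_def linked_def)
  ultimately show ?thesis
    by (rule two_stepI[where y = y]) (use y closed_part_diff[OF assms(3)] img in auto)
qed

text \<open>The first step goes along the path \<open>D\<close>, but starts with the misplaced item \<open>a\<close> instead of
\<open>b\<close>; the second one moves \<open>b\<close>, then \<open>a\<close> out of the cluster that \<open>b\<close> has entered, and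
continues along \<open>C\<close>.\<close>

lemma two_step_paths:
  assumes ex: "exchange f g M" and C: "closed_part f g M C" "linked f g C" and D: "closed_part f g M D" "linked f g D"
    and disj: "C \<inter> D = {}" and a: "a \<in> C" "f a \<notin> g ` M" and b: "b \<in> D" "f b \<notin> g ` M"
  shows "two_step f g M (C \<union> D)"
proof -
  have inj: "inj_on f M" "inj_on g M" using ex by (auto simp: exchange_def)
  have ne: "f x \<noteq> g x" if "x \<in> M" for x using ex that by (simp add: exchange_def)
  have sub: "C \<subseteq> M" "D \<subseteq> M" using C D by (auto simp: closed_part_def)
  have "a \<noteq> b" using a b disj by blast
  define f1 where "f1 x = (if x = a then g b else if x \<in> D - {b} then g x else f x)" for x
  let ?S = "insert a (D - {b})" and ?T = "insert b C" and ?h = "override_on f g (C \<union> D)"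
  have clD: "x \<in> D \<longleftrightarrow> z \<in> D" if "x \<in> M" "z \<in> M" "g x = f z" for x z
    using D that by (auto simp: closed_part_def)
  have f1D: "f1 x = g x" if "x \<in> D - {b}" for x using that a disj by (auto simp: f1_def)
  have f1C: "f1 x = f x" if "x \<in> C - {a}" for x using that disj by (auto simp: f1_def)
  have f1a: "f1 a = g b" and f1b: "f1 b = f b" using \<open>a \<noteq> b\<close> by (auto simp: f1_def)
  have imgS: "f1 ` ?S = g ` D" using f1D f1a b by (auto simp: image_iff)
  have "chain f f1 ?S"
    unfolding chain_def
  proof (intro conjI allI impI)
    show "inj_on f ?S" by (rule inj_on_subset[OF inj(1)]) (use sub a in auto)
    show "inj_on f1 ?S"
    proof (rule inj_onI)
      fix x z assume xz: "x \<in> ?S" "z \<in> ?S" "f1 x = f1 z"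
      have "f1 u = g (if u = a then b else u)" if "u \<in> ?S" for u using that f1D f1a by auto
      then have "(if x = a then b else x) = (if z = a then b else z)"
        using xz inj(2) sub b by (intro inj_onD[OF inj(2)]) auto
      then show "x = z" using xz by (auto split: if_splits)
    qed
    show "linked f f1 ?S"
      unfolding linked_def
    proof (intro allI impI ballI)
      fix \<beta> :: "'a \<Rightarrow> real" and x z
      assume \<beta>: "\<forall>x\<in>?S. \<forall>z\<in>?S. f1 x = f z \<longrightarrow> \<beta> x = \<beta> z" and xz: "x \<in> ?S" "z \<in> ?S"
      \<comment> \<open>In the first step \<open>a\<close> takes over the role of \<open>b\<close>
        on the path \<open>D\<close>. Giving \<open>b\<close> the label of \<open>a\<close> thus
        reduces the claim to the linkedness of \<open>D\<close>.\<close>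
      have "(\<beta>(b := \<beta> a)) u = (\<beta>(b := \<beta> a)) v" if "u \<in> D" "v \<in> D" for u v
      proof (rule linkedD[OF D(2) _ that])
        fix u v assume uv: "u \<in> D" "v \<in> D" "g u = f v"
        then have "v \<noteq> b" using b(2) sub by (metis imageI subsetD)
        then show "(\<beta>(b := \<beta> a)) u = (\<beta>(b := \<beta> a)) v"
          using \<beta> uv f1D[of u] f1a by (cases "u = b") auto
      qed
      moreover have "(if u = a then b else u) \<in> D \<and> \<beta> u = (\<beta>(b := \<beta> a)) (if u = a then b else u)"
        if "u \<in> ?S" for u using that b(1) by auto
      ultimately show "\<beta> x = \<beta> z" using xz by presburger
    qed
  qed (auto simp: f1_def)
  moreover have "chain f1 ?h ?T"
    unfolding chain_def
  proof (intro conjI allI impI)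
    have gb: "g b \<noteq> f x" if "x \<in> C" for x using clD[of b x] that sub b disj by blast
    show "inj_on f1 ?T"
    proof (rule inj_onI)
      fix x z assume xz: "x \<in> ?T" "z \<in> ?T" "f1 x = f1 z"
      have *: "f1 u = f u" if "u \<in> ?T" "u \<noteq> a" for u using that f1b f1C by auto
      have "f u \<noteq> g b" if "u \<in> ?T" for u using that gb ne[of b] b sub by (metis insert_iff subsetD)
      then show "x = z"
        using xz * f1a inj_onD[OF inj(1), of x z] sub b by (metis insert_iff subsetD)
    qed
    have hT: "?h x = g x" if "x \<in> ?T" for x using that b by (auto simp: override_on_def)
    show "inj_on ?h ?T"
      using inj_on_subset[OF inj(2), of ?T] sub b hT by (auto simp: inj_on_def)
    show "?h x = f1 x" if "x \<notin> ?T" for x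
      using that a disj by (auto simp: override_on_def f1_def)
    show "linked f1 ?h ?T"
      unfolding linked_def
    proof (intro allI impI)
      fix \<beta> :: "'a \<Rightarrow> real"
      assume \<beta>: "\<forall>x\<in>?T. \<forall>z\<in>?T. ?h x = f1 z \<longrightarrow> \<beta> x = \<beta> z"
      have "\<beta> b = \<beta> a" using \<beta> hT[of b] f1a a by auto
      moreover have "\<beta> u = \<beta> v" if "u \<in> C" "v \<in> C" for u v
      proof (rule linkedD[OF C(2) _ that])
        fix u v assume uv: "u \<in> C" "v \<in> C" "g u = f v"
        then have "v \<noteq> a" using a(2) sub by (metis imageI subsetD)
        then show "\<beta> u = \<beta> v" using \<beta> uv f1C[of v] hT[of u] by auto
      qed
      ultimately show "\<forall>x\<in>?T. \<forall>z\<in>?T. \<beta> x = \<beta> z" using a(1) by (metis insert_iff)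
    qed
  qed auto
  moreover have "f1 ` (C \<union> D) \<subseteq> f ` (C \<union> D) \<union> g ` (C \<union> D)"
    using b by (auto simp: f1_def)
  moreover have "f ` ?S - f1 ` ?S \<subseteq> f ` M - g ` M"
  proof
    fix i assume "i \<in> f ` ?S - f1 ` ?S"
    then obtain z where z: "z \<in> ?S" "i = f z" "f z \<notin> g ` D" unfolding imgS by blast
    have "f z \<notin> g ` M"
      using z a(2) clD sub by (cases "z = a") auto
    then show "i \<in> f ` M - g ` M" using z a(1) sub by auto
  qed
  moreover have "f1 ` ?S - f ` ?S \<subseteq> g ` M - f ` M"
  proof
    fix i assume "i \<in> f1 ` ?S - f ` ?S"
    then obtain x where x: "x \<in> D" "i = g x" "g x \<notin> f ` ?S" unfolding imgS by blast
    have "g x \<notin> f ` M"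
    proof
      assume "g x \<in> f ` M"
      then obtain z where z: "z \<in> M" "g x = f z" by blast
      then have "z \<in> D" using clD[of x z] x(1) sub by auto
      moreover have "z \<noteq> b" using z x(1) sub b(2) by (metis imageI subsetD)
      ultimately show False using x(3) z(2) by auto
    qed
    then show "i \<in> g ` M - f ` M" using x sub by auto
  qed
  ultimately show ?thesis by (rule two_stepI[where y = a]) (use a b in auto)
qed

text \<open>The cycle is inserted behind the item \<open>y\<close> in the first step; the last item \<open>l\<close> of the
cycle and \<open>y\<close> exchange their destinations, which is corrected in the second step.\<close>

lemma two_step_insert_cycle:
  fixes f g :: "'n::finite \<Rightarrow> 'k"
  assumes ex: "exchange f g M" and N: "closed_part f g M N" and L: "closed_part f g M L" "linked f g L" "L \<noteq> {}"
    and disj: "N \<inter> L = {}" and cyc: "f ` L \<subseteq> g ` L" and ts: "two_step f g M N"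
  shows "two_step f g M (N \<union> L)"
proof -
  obtain f1 S T y where ch1: "chain f f1 S" and ch2: "chain f1 (override_on f g N) T"
    and y: "y \<in> S" "y \<in> T" and sub: "S \<subseteq> N" "T \<subseteq> N" and f1N: "f1 ` N \<subseteq> f ` N \<union> g ` N"
    and gain: "f ` S - f1 ` S \<subseteq> f ` M - g ` M" "f1 ` S - f ` S \<subseteq> g ` M - f ` M"
    using ts unfolding two_step_def by (elim exE conjE) (rule that)
  obtain l where l: "l \<in> L" using L(3) by blast
  have inj: "inj_on f M" "inj_on g M" using ex by (auto simp: exchange_def)
  have subM: "N \<subseteq> M" "L \<subseteq> M" using N L by (auto simp: closed_part_def)
  have injL: "inj_on f L" "inj_on g L" using inj subM inj_on_subset by blast+
  have img: "f ` L = g ` L" using cyc injL by (intro card_subset_eq) (auto simp: card_image)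
  have c1: "inj_on f S" "inj_on f1 S" "\<And>x. x \<notin> S \<Longrightarrow> f1 x = f x" "linked f f1 S"
    and c2: "inj_on f1 T" "\<And>x. x \<notin> T \<Longrightarrow> override_on f g N x = f1 x" "linked f1 (override_on f g N) T"
    using ch1 ch2 by (auto simp: chain_def)
  have f1L: "f1 x = f x" if "x \<in> L" for x using c1(3) that sub disj by blast
  \<comment> \<open>An edge of \<open>N\<close> entering a cluster left by \<open>L\<close> would
    put an item of \<open>L\<close> into \<open>N\<close>. Hence the steps on \<open>N\<close> avoid
    the clusters of the cycle, and splicing preserves injectivity.\<close>
  have "f z \<noteq> g x" if "z \<in> L" "x \<in> N" for x z
    using N subM disj that unfolding closed_part_def by (metis disjoint_iff subsetD)
  then have "f ` L \<inter> g ` N = {}" by blast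
  moreover have "f ` L \<inter> f ` N = {}"
    using inj(1) subM disj by (metis image_empty inf_commute inj_on_image_Int)
  ultimately have sep: "g ` L \<inter> f1 ` N = {}" using f1N unfolding img by blast
  have ly: "l \<noteq> y" "y \<notin> L" using l y sub disj by auto
  \<comment> \<open>\<open>k\<close> performs the cycle independently of \<open>f1\<close>;
    interchanging the images of \<open>y\<close> and \<open>l\<close> then joins the two into one
    chain.\<close>
  define k where "k = override_on f1 g L"
  define f2 where "f2 = k \<circ> Transposition.transpose y l"
  have kL: "k x = g x" if "x \<in> L" for x using that by (simp add: k_def)
  have kN: "k x = f1 x" if "x \<notin> L" for x using that by (simp add: k_def)
  have f2y: "f2 y = g l" and f2l: "f2 l = f1 y" using l ly kL kN by (simp_all add: f2_def)
  have f2o: "f2 x = k x" if "x \<noteq> y" "x \<noteq> l" for x using that by (simp add: f2_def Transposition.transpose_def)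
  have kinj: "inj_on k (A \<union> B)" if "inj_on f1 A" "A \<subseteq> N" "B \<subseteq> L" for A B
  proof -
    have "inj_on k A" "inj_on k B"
      using that injL(2) kL kN disj by (auto simp: inj_on_def subset_iff disjoint_iff)
    moreover have "k ` A \<inter> k ` B = {}"
    proof -
      have "k ` A = f1 ` A" by (rule image_cong) (use that kN disj in auto)
      moreover have "k ` B = g ` B" by (rule image_cong) (use that kL in auto)
      ultimately show ?thesis using sep that by blast
    qed
    ultimately show ?thesis by (auto simp: inj_on_Un)
  qed
  have f2inj: "inj_on f2 (A \<union> B)" if "inj_on f1 A" "A \<subseteq> N" "B \<subseteq> L" "y \<in> A" "l \<in> B" for A B
    unfolding f2_def
  proof (rule comp_inj_on)
    have "Transposition.transpose y l ` (A \<union> B) = A \<union> B" using that by (intro transpose_image_eq) auto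
    then show "inj_on k (Transposition.transpose y l ` (A \<union> B))" using kinj that by simp
  qed simp
  have f2img: "f2 ` (A \<union> L) = f1 ` A \<union> g ` L" if "A \<subseteq> N" "y \<in> A" for A
  proof -
    have "Transposition.transpose y l ` (A \<union> L) = A \<union> L" using that l by (intro transpose_image_eq) auto
    then have "f2 ` (A \<union> L) = k ` A \<union> k ` L" unfolding f2_def image_comp[symmetric] by (simp add: image_Un)
    moreover have "k ` A = f1 ` A" by (rule image_cong) (use that kN disj in auto)
    moreover have "k ` L = g ` L" by (rule image_cong) (use kL in auto)
    ultimately show ?thesis by simp
  qed
  have "chain f f2 (S \<union> L)"
    unfolding chain_def
  proof (intro conjI allI impI)
    show "inj_on f (S \<union> L)" by (rule inj_on_subset[OF inj(1)]) (use sub subM in auto)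
    show "inj_on f2 (S \<union> L)" by (rule f2inj[OF c1(2) sub(1) subset_refl y(1) l])
    show "f2 x = f x" if "x \<notin> S \<union> L" for x
    proof -
      have "x \<noteq> y" "x \<noteq> l" "x \<notin> L" "x \<notin> S" using that y l by auto
      then show ?thesis using f2o kN c1(3) by simp
    qed
    show "linked f f2 (S \<union> L)"
      unfolding linked_def
    proof (intro allI impI)
      fix \<beta> :: "'n \<Rightarrow> real"
      assume \<beta>: "\<forall>x\<in>S \<union> L. \<forall>z\<in>S \<union> L. f2 x = f z \<longrightarrow> \<beta> x = \<beta> z"
      \<comment> \<open>In \<open>f2\<close> the item \<open>l\<close> no longer precedes its
        successor on the cycle; the other links of \<open>L\<close> survive.\<close>
      have onL: "\<beta> x = \<beta> z" if "x \<in> L" "z \<in> L" for x z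
      proof (rule linked_cut[OF L(2) injL img l _ that])
        fix x z assume "x \<in> L - {l}" "z \<in> L" "g x = f z"
        moreover from this have "f2 x = g x" using f2o[of x] kL ly by auto
        ultimately show "\<beta> x = \<beta> z" using \<beta>[rule_format, of x z] by simp
      qed
      obtain h where h: "h \<in> L" "g l = f h" using img l by blast
      have yL: "\<beta> y = \<beta> x" if "x \<in> L" for x
        using \<beta>[rule_format, of y h] h f2y y onL[OF h(1) that] by simp
      have "\<beta> x = \<beta> z" if "x \<in> S" "z \<in> S" for x z
      proof (rule linkedD[OF c1(4) _ that])
        fix x z assume xz: "x \<in> S" "z \<in> S" "f1 x = f z"
        show "\<beta> x = \<beta> z"
        proof (cases "x = y")
          case True
          then have "\<beta> l = \<beta> z" using \<beta>[rule_format, of l z] l xz f2l by simp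
          then show ?thesis using yL[OF l] True by simp
        next
          case False
          have "x \<notin> L" using xz sub disj by blast
          then have "f2 x = f1 x" using f2o[of x] kN False l by auto
          then show ?thesis using \<beta>[rule_format, of x z] xz by simp
        qed
      qed
      then show "\<forall>x\<in>S \<union> L. \<forall>z\<in>S \<union> L. \<beta> x = \<beta> z" using yL y by (metis Un_iff)
    qed
  qed (use y in auto)
  moreover have "chain f2 (override_on f g (N \<union> L)) (T \<union> {l})"
    unfolding chain_def
  proof (intro conjI allI impI)
    let ?h = "override_on f g (N \<union> L)"
    have hT: "?h x = g x" if "x \<in> N \<union> L" for x using that by (simp add: override_on_def)
    show "inj_on f2 (T \<union> {l})" by (rule f2inj[OF c2(1) sub(2) _ y(2) singletonI]) (simp add: l)
    have "T \<union> {l} \<subseteq> M" using sub l subM by blast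
    then have "inj_on g (T \<union> {l})" by (rule inj_on_subset[OF inj(2)])
    then show "inj_on ?h (T \<union> {l})"
      using hT l sub by (subst inj_on_cong[of _ _ g]) auto
    show "?h x = f2 x" if "x \<notin> T \<union> {l}" for x
    proof -
      have x: "x \<noteq> y" "x \<noteq> l" "x \<notin> T" using that y by auto
      show ?thesis
      proof (cases "x \<in> L")
        case True
        then show ?thesis using hT f2o x kL by simp
      next
        case False
        then have "?h x = override_on f g N x" by (simp add: override_on_def)
        then show ?thesis using f2o[OF x(1,2)] kN[OF False] c2(2)[OF x(3)] by simp
      qed
    qed
    show "linked f2 ?h (T \<union> {l})"
      unfolding linked_def
    proof (intro allI impI)
      fix \<beta> :: "'n \<Rightarrow> real"
      assume \<beta>: "\<forall>x\<in>T \<union> {l}. \<forall>z\<in>T \<union> {l}. ?h x = f2 z \<longrightarrow> \<beta> x = \<beta> z"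
      \<comment> \<open>In the second step \<open>l\<close> is spliced in before \<open>y\<close>:
        it moves to \<open>g l\<close>, where \<open>y\<close> has been misplaced, and whatever
        entered \<open>f1 y\<close> now precedes \<open>l\<close>, because
        \<open>f2 l = f1 y\<close>.\<close>
      have ly': "\<beta> l = \<beta> y" using \<beta>[rule_format, of l y] hT[of l] l y f2y by simp
      have "\<beta> x = \<beta> z" if "x \<in> T" "z \<in> T" for x z
      proof (rule linkedD[OF c2(3) _ that])
        fix x z assume xz: "x \<in> T" "z \<in> T" "override_on f g N x = f1 z"
        have eq: "?h x = f1 z" using xz sub by (auto simp: override_on_def)
        show "\<beta> x = \<beta> z"
        proof (cases "z = y")
          case True
          then have "\<beta> x = \<beta> l" using \<beta>[rule_format, of x l] xz eq f2l by simp
          then show ?thesis using ly' True by simp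
        next
          case False
          have "z \<notin> L" using xz sub disj by blast
          then have "f2 z = f1 z" using f2o[of z] kN False l by auto
          then show ?thesis using \<beta>[rule_format, of x z] xz eq by simp
        qed
      qed
      then show "\<forall>x\<in>T \<union> {l}. \<forall>z\<in>T \<union> {l}. \<beta> x = \<beta> z" using ly' y by (metis Un_iff singletonD)
    qed
  qed auto
  moreover have "f2 ` (N \<union> L) \<subseteq> f ` (N \<union> L) \<union> g ` (N \<union> L)"
    unfolding f2img[OF subset_refl subsetD[OF sub(1) y(1)]] using f1N by blast
  moreover have "f ` (S \<union> L) - f2 ` (S \<union> L) \<subseteq> f ` M - g ` M"
    unfolding f2img[OF sub(1) y(1)] using gain(1) img by auto
  moreover have "f2 ` (S \<union> L) - f ` (S \<union> L) \<subseteq> g ` M - f ` M"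
    unfolding f2img[OF sub(1) y(1)] using gain(2) img by auto
  ultimately show ?thesis by (rule two_stepI[where y = y]) (use y sub l in auto)
qed

text \<open>Once \<open>N\<close> contains the first item of every path, all remaining components
  are cycles, and these can be inserted one at a time.\<close>

lemma two_step_extend:
  fixes f g :: "'n::finite \<Rightarrow> 'k"
  assumes "exchange f g M" "closed_part f g M N" "two_step f g M N"
    "\<And>x. x \<in> M \<Longrightarrow> f x \<notin> g ` M \<Longrightarrow> x \<in> N"
  shows "two_step f g M M"
  using assms(2-)
proof (induction "card (M - N)" arbitrary: N rule: less_induct)
  case less
  have NM: "N \<subseteq> M" using less.prems by (simp add: closed_part_def)
  show ?case
  proof (cases "N = M")
    case False
    then obtain x where x: "x \<in> M" "x \<notin> N" using NM by blast
    obtain L where L: "x \<in> L" "closed_part f g M L" "linked f g L" "L \<inter> N = {}"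
      using component[OF x(1), of f g] x(2) less.prems(1) by metis
    have LM: "L \<subseteq> M" using L by (simp add: closed_part_def)
    have cyc: "f ` L \<subseteq> g ` L"
    proof (rule image_subsetI)
      fix z assume z: "z \<in> L"
      then have "z \<notin> N" "z \<in> M" using L(4) LM by auto
      then obtain u where u: "u \<in> M" "f z = g u" using less.prems(3)[of z] by blast
      then have "u \<in> L" using L(2) z \<open>z \<in> M\<close> unfolding closed_part_def by auto
      then show "f z \<in> g ` L" using u by simp
    qed
    have "two_step f g M (N \<union> L)"
      using two_step_insert_cycle[OF assms(1) less.prems(1) L(2,3) _ _ cyc less.prems(2)] L(1,4) by blast
    moreover have "closed_part f g M (N \<union> L)"
      using less.prems(1) L(2) unfolding closed_part_def by blast
    moreover have "card (M - (N \<union> L)) < card (M - N)"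
      using L(1) x by (intro psubset_card_mono) auto
    ultimately show ?thesis using less.hyps[of "N \<union> L"] less.prems(3) by blast
  qed (use less.prems in simp)
qed

text \<open>\<open>U\<close> consists of the first items of the paths. One component, or two if the
  paths are separate, covers \<open>U\<close>, and the cycles are added afterwards.\<close>

lemma two_step_exchange:
  fixes f g :: "'n::finite \<Rightarrow> 'k"
  assumes ex: "exchange f g M" and "M \<noteq> {}" and two: "card (f ` M - g ` M) \<le> 2"
  shows "two_step f g M M"
proof -
  define U where "U = {x\<in>M. f x \<notin> g ` M}"
  have "inj_on f U" using ex by (auto simp: exchange_def U_def inj_on_def)
  moreover have "f ` U = f ` M - g ` M" by (auto simp: U_def)
  ultimately have cU: "card U \<le> 2" using two by (metis card_image)
  \<comment> \<open>Without any path, \<open>a\<close> is an arbitrary item, and its component is a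
    cycle.\<close>
  obtain a where a: "a \<in> M" "U \<noteq> {} \<Longrightarrow> a \<in> U" using \<open>M \<noteq> {}\<close> by (auto simp: U_def)
  obtain C where C: "a \<in> C" "closed_part f g M C" "linked f g C"
    "\<And>N. closed_part f g M N \<Longrightarrow> a \<notin> N \<Longrightarrow> C \<inter> N = {}"
    using component[OF a(1), of f g] by blast
  show ?thesis
  proof (cases "U \<subseteq> C")
    case True
    then show ?thesis
      using two_step_extend[OF ex C(2) two_step_component[OF _ ex C(2,3)]] C(1) by (auto simp: U_def)
  next
    case False
    then obtain b where b: "b \<in> U" "b \<notin> C" by blast
    then have aU: "a \<in> U" using a by blast
    have "b \<in> M" using b by (simp add: U_def)
    then obtain D where D: "b \<in> D" "closed_part f g M D" "linked f g D" "D \<inter> C = {}"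
      using component[of b M f g] b(2) C(2) by metis
    have U: "U = {a, b}"
    proof (rule card_seteq[symmetric])
      show "card U \<le> card {a, b}" using cU b(2) C(1) by (auto simp: card_insert_if)
    qed (use aU b in auto)
    have "x \<in> C \<union> D" if "x \<in> M" "f x \<notin> g ` M" for x
    proof -
      have "x \<in> U" using that by (simp add: U_def)
      then show ?thesis using U C(1) D(1) by blast
    qed
    moreover have "closed_part f g M (C \<union> D)"
      using C(2) D(2) unfolding closed_part_def by blast
    moreover have "two_step f g M (C \<union> D)"
      using aU b(1) C(1) D(1,4) by (intro two_step_paths[OF ex C(2,3) D(2,3)]) (auto simp: U_def)
    ultimately show ?thesis using two_step_extend[OF ex] by blast
  qed
qed

section \<open>Counting moves and feasibility of the intermediate assignments\<close>

lemma reach_refl: "reach \<kappa>p \<kappa>m n f f"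
  unfolding reach_def by (intro exI[of _ 0]) simp

lemma reach_mono: "reach \<kappa>p \<kappa>m n f g \<Longrightarrow> n \<le> n' \<Longrightarrow> reach \<kappa>p \<kappa>m n' f g"
  unfolding reach_def by (meson le_trans)

lemma reach_trans: "reach \<kappa>p \<kappa>m m f g \<Longrightarrow> reach \<kappa>p \<kappa>m n g h \<Longrightarrow> reach \<kappa>p \<kappa>m (m + n) f h"
  unfolding reach_def
proof (elim exE conjE)
  fix r s assume "r \<le> m" "(f, g) \<in> moves \<kappa>p \<kappa>m ^^ r" "s \<le> n" "(g, h) \<in> moves \<kappa>p \<kappa>m ^^ s"
  then have "(f, h) \<in> moves \<kappa>p \<kappa>m ^^ (r + s)" "r + s \<le> m + n"
    by (auto simp: relpow_add)
  then show "\<exists>k\<le>m + n. (f, h) \<in> moves \<kappa>p \<kappa>m ^^ k" by blast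
qed

lemma reach_chain:
  assumes "chain f f' S" "feasible \<kappa>p \<kappa>m f" "feasible \<kappa>p \<kappa>m f'"
  shows "reach \<kappa>p \<kappa>m 1 f f'"
proof (cases "f = f'")
  case False
  then have "(f, f') \<in> moves \<kappa>p \<kappa>m ^^ 1" using assms by (auto simp: moves_def)
  then show ?thesis unfolding reach_def by blast
qed (simp add: reach_refl)

lemma feasible_shift:
  fixes f :: "'n::finite \<Rightarrow> 'k"
  assumes "inj_on f S" "inj_on f' S" "\<And>x. x \<notin> S \<Longrightarrow> f' x = f x" "feasible \<kappa>p \<kappa>m f"
    and "\<And>i. i \<in> f ` S - f' ` S \<Longrightarrow> \<kappa>m i < cnt f i" "\<And>i. i \<in> f' ` S - f ` S \<Longrightarrow> cnt f i < \<kappa>p i"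
  shows "feasible \<kappa>p \<kappa>m f'"
  unfolding feasible_def
proof
  fix i
  show "\<kappa>m i \<le> cnt f' i \<and> cnt f' i \<le> \<kappa>p i"
    using cnt_chain[OF assms(1-3), of i] assms(4)[unfolded feasible_def, rule_format, of i]
      assms(5,6)[of i]
    by (cases "i \<in> f ` S"; cases "i \<in> f' ` S") simp_all
qed

context
  fixes f g :: "'n::finite \<Rightarrow> 'k" and \<kappa>p \<kappa>m :: "'k \<Rightarrow> nat" and M
  assumes feas: "feasible \<kappa>p \<kappa>m f" "feasible \<kappa>p \<kappa>m g" and ex: "exchange f g M"
begin

text \<open>The start of a path has more items under \<open>f\<close> than under \<open>g\<close>,
  and \<open>g\<close> respects the lower bound; the end of a path is symmetric.\<close>

lemma exchange_room:
  "i \<in> f ` M - g ` M \<Longrightarrow> \<kappa>m i < cnt f i" "i \<in> g ` M - f ` M \<Longrightarrow> cnt f i < \<kappa>p i"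
proof -
  have "\<kappa>m i \<le> cnt g i" "cnt g i \<le> \<kappa>p i" using feas(2) by (auto simp: feasible_def)
  moreover have "i \<in> f ` M - g ` M \<Longrightarrow> leaving g f i < leaving f g i"
      "i \<in> g ` M - f ` M \<Longrightarrow> leaving f g i < leaving g f i"
    using ex by (auto simp: exchange_def)
  ultimately show "i \<in> f ` M - g ` M \<Longrightarrow> \<kappa>m i < cnt f i" "i \<in> g ` M - f ` M \<Longrightarrow> cnt f i < \<kappa>p i"
    using cnt_leaving[of f i g] by linarith+
qed

lemma feasible_exchange: "feasible \<kappa>p \<kappa>m (override_on f g M)"
proof (rule feasible_shift[OF _ _ _ feas(1)])
  have "override_on f g M ` M = g ` M" by (auto simp: override_on_def)
  then show "i \<in> f ` M - override_on f g M ` M \<Longrightarrow> \<kappa>m i < cnt f i"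
    "i \<in> override_on f g M ` M - f ` M \<Longrightarrow> cnt f i < \<kappa>p i" for i
    using exchange_room[of i] by auto
qed (use ex in \<open>auto simp: exchange_def inj_on_def override_on_def\<close>)

lemma reach_two_exchange:
  assumes "card (f ` M - g ` M) \<le> 2"
  shows "reach \<kappa>p \<kappa>m 2 f (override_on f g M)"
proof (cases "M = {}")
  case False
  obtain f1 S T where ch: "chain f f1 S" "chain f1 (override_on f g M) T"
    and gain: "f ` S - f1 ` S \<subseteq> f ` M - g ` M" "f1 ` S - f ` S \<subseteq> g ` M - f ` M"
    using two_step_exchange[OF ex False assms] unfolding two_step_def
    by (elim exE conjE) (rule that)
  have "feasible \<kappa>p \<kappa>m f1"
    using ch(1) gain exchange_room by (intro feasible_shift[OF _ _ _ feas(1), of S]) (auto simp: chain_def)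
  then have "reach \<kappa>p \<kappa>m (1 + 1) f (override_on f g M)"
    using reach_trans[OF reach_chain reach_chain] ch feas(1) feasible_exchange by metis
  then show ?thesis unfolding one_add_one .
qed (simp add: reach_refl)

lemma reach_one_exchange:
  assumes "linked f g M"
  shows "reach \<kappa>p \<kappa>m 1 f (override_on f g M)"
proof (cases "M = {}")
  case False
  have "chain f (override_on f g M) M"
    using False assms ex by (auto simp: chain_def exchange_def inj_on_def override_on_def linked_def)
  then show ?thesis using reach_chain feas(1) feasible_exchange by blast
qed (simp add: reach_refl)

end

subsection \<open>Existence of covers and the bound\<close>

text \<open>A permutation in the support of the degree matrix with two hubs decomposes into cycles.
  Deleting fixed points and hubs leaves cycles and at most two paths of clusters. The last
  conclusion says that the remaining surplus is at most \<open>2 * (c - 1)\<close>, as the next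
  round with \<open>c - 1\<close> requires.\<close>

lemma exchange_exists:
  fixes f g :: "'n::finite \<Rightarrow> 'k::finite"
  assumes "c > 0" and deg: "\<And>i. leaving f g i \<le> c" "\<And>i. leaving g f i \<le> c"
    and exc: "excess f g \<le> 2 * c"
  obtains M where "exchange f g M" "card (f ` M - g ` M) \<le> 2"
    "\<And>i. leaving f g i = c \<Longrightarrow> i \<in> f ` M" "\<And>i. leaving g f i = c \<Longrightarrow> i \<in> g ` M"
    "excess f g \<le> 2 * c - 2 + card (f ` M - g ` M)"
proof -
  define H where "H = real (excess f g)"
  \<comment> \<open>The hub \<open>False\<close> takes as much of the surplus as its capacity \<open>c\<close> allows, so that it is
    saturated as soon as \<open>H \<ge> c\<close>.\<close>
  define \<mu> where "\<mu> b = (let t = if H \<le> c then 1 else c / H in if b then 1 - t else t)" for b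
  define s where "s i = leaving f g i - leaving g f i" for i
  define d where "d i = leaving g f i - leaving f g i" for i
  define m :: "'k + bool \<Rightarrow> 'k + bool \<Rightarrow> real" where
    "m u v = (case u of
        Inl i \<Rightarrow> (case v of
            Inl j \<Rightarrow> if i = j then c - max (real (leaving f g i)) (leaving g f i)
              else card {x. f x = i \<and> g x = j}
          | Inr b \<Rightarrow> \<mu> b * d i)
      | Inr b \<Rightarrow> (case v of
            Inl i \<Rightarrow> \<mu> b * s i
          | Inr b' \<Rightarrow> if b = b' then c - \<mu> b * H else 0))" for u v
  have sumH: "(\<Sum>i\<in>UNIV. real (s i)) = H" "(\<Sum>i\<in>UNIV. real (d i)) = H"
    unfolding H_def s_def d_def by (simp add: excess_def, subst excess_commute, simp add: excess_def)
  have "H \<ge> 0" by (simp add: H_def)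
  have \<mu>: "\<mu> False + \<mu> True = 1" "\<mu> b \<ge> 0" for b
    using \<open>c > 0\<close> by (auto simp: \<mu>_def Let_def)
  have \<mu>F: "\<mu> False * H = min H c"
    using \<open>c > 0\<close> by (auto simp: \<mu>_def Let_def)
  have \<mu>T: "\<mu> True * H = H - min H c"
    using \<mu>F \<mu>(1) by (metis add_diff_cancel_left' distrib_right mult_1)
  have \<mu>c: "\<mu> b * H \<le> c" for b
    using \<mu>F \<mu>T exc by (cases b) (auto simp: H_def)
  have sum_all: "(\<Sum>u\<in>UNIV. w u) = (\<Sum>i\<in>UNIV. w (Inl i)) + w (Inr False) + w (Inr True)"
    for w :: "'k + bool \<Rightarrow> real"
    by (simp add: UNIV_sum UNIV_bool image_iff sum.reindex)
  have bal: "c - max (real (leaving f g i)) (leaving g f i) + leaving f g i + d i = c"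
    "c - max (real (leaving f g i)) (leaving g f i) + leaving g f i + s i = c" for i
    by (auto simp: d_def s_def max_def of_nat_diff)
  have row: "(\<Sum>v\<in>UNIV. m u v) = c" for u
  proof (cases u)
    case (Inl i)
    have "(\<Sum>j\<in>UNIV. m (Inl i) (Inl j)) = m (Inl i) (Inl i) + (\<Sum>j\<in>UNIV - {i}. m (Inl i) (Inl j))"
      by (simp add: sum.remove)
    also have "(\<Sum>j\<in>UNIV - {i}. m (Inl i) (Inl j)) = leaving f g i"
      unfolding leaving_eq_sum of_nat_sum by (intro sum.cong) (auto simp: m_def)
    finally have "(\<Sum>v\<in>UNIV. m u v) = c - max (real (leaving f g i)) (leaving g f i) + leaving f g i
        + (\<mu> False + \<mu> True) * d i"
      unfolding Inl sum_all by (simp add: m_def algebra_simps)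
    then show ?thesis using bal(1)[of i] by (simp add: \<mu>(1))
  next
    case (Inr b)
    then show ?thesis
      unfolding sum_all by (cases b) (simp_all add: m_def sumH flip: sum_distrib_left)
  qed
  have col: "(\<Sum>u\<in>UNIV. m u v) = c" for v
  proof (cases v)
    case (Inl i)
    have "(\<Sum>j\<in>UNIV. m (Inl j) (Inl i)) = m (Inl i) (Inl i) + (\<Sum>j\<in>UNIV - {i}. m (Inl j) (Inl i))"
      by (simp add: sum.remove)
    also have "(\<Sum>j\<in>UNIV - {i}. m (Inl j) (Inl i)) = leaving g f i"
      unfolding leaving_eq_sum of_nat_sum by (intro sum.cong) (auto simp: m_def conj_commute)
    finally have "(\<Sum>u\<in>UNIV. m u v) = c - max (real (leaving f g i)) (leaving g f i) + leaving g f i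
        + (\<mu> False + \<mu> True) * s i"
      unfolding Inl sum_all by (simp add: m_def algebra_simps)
    then show ?thesis using bal(2)[of i] by (simp add: \<mu>(1))
  next
    case (Inr b)
    then show ?thesis
      unfolding sum_all by (cases b) (simp_all add: m_def sumH flip: sum_distrib_left)
  qed
  have nonneg: "m u v \<ge> 0" for u v
    using \<mu>(2) \<mu>c deg by (auto simp: m_def split: sum.split)
  obtain \<pi> where \<pi>: "bij \<pi>" "\<And>u. m u (\<pi> u) > 0"
    using positive_permutation[OF nonneg _ row col] \<open>c > 0\<close> by auto
  have \<pi>inj: "\<pi> u = \<pi> v \<Longrightarrow> u = v" for u v using \<pi>(1) by (simp add: bij_def inj_eq)
  have pos: "m u v > 0" if "\<pi> u = v" for u v using \<pi>(2)[of u] that by simp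
  \<comment> \<open>The edges of the permutation between distinct clusters. A positive entry counts
    items, so each such edge is realised by some item \<open>X i j\<close>.\<close>
  define P where "P i j \<longleftrightarrow> \<pi> (Inl i) = Inl j \<and> i \<noteq> j" for i j
  have "\<exists>x. f x = i \<and> g x = j" if "P i j" for i j
  proof -
    have "card {x. f x = i \<and> g x = j} > 0" using pos[of "Inl i" "Inl j"] that by (simp add: P_def m_def)
    then show ?thesis by (auto simp: card_gt_0_iff)
  qed
  then obtain X where X: "\<And>i j. P i j \<Longrightarrow> f (X i j) = i \<and> g (X i j) = j" by metis
  define M where "M = {X i j | i j. P i j}"
  have PM: "P (f x) (g x)" if "x \<in> M" for x using that X by (auto simp: M_def)
  have inf: "i \<in> f ` M" if "P i j" for i j
    using X[OF that] that by (force simp: M_def image_iff)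
  have ing: "j \<in> g ` M" if "P i j" for i j
    using X[OF that] that by (force simp: M_def image_iff)
  have Mx: "x = X (f x) (g x)" if "x \<in> M" for x using that X by (auto simp: M_def)
  have Pr: "P i j \<Longrightarrow> P i j' \<Longrightarrow> j = j'" and Pl: "P i j \<Longrightarrow> P i' j \<Longrightarrow> i = i'" for i j i' j'
    using \<pi>inj[of "Inl i" "Inl i'"] by (auto simp: P_def)
  have injM: "inj_on f M" "inj_on g M"
    by (intro inj_onI; metis PM Mx Pr Pl)+
  have start: "\<exists>b. \<pi> (Inr b) = Inl i" if i: "i \<in> f ` M - g ` M" for i
  proof -
    obtain j where j: "P i j" using i PM by blast
    obtain u where u: "\<pi> u = Inl i" using \<pi>(1) by (metis bij_pointE)
    show ?thesis
    proof (cases u)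
      case (Inl i')
      then have "i' \<noteq> i" using j u by (auto simp: P_def)
      then have "P i' i" using u Inl by (simp add: P_def)
      then show ?thesis using ing i by blast
    qed (use u in blast)
  qed
  \<comment> \<open>A cluster fed by a hub has a surplus, so its own successor is neither a hub nor,
    by injectivity, the cluster itself: it is the start of a path.\<close>
  have hub: "leaving g f i < leaving f g i" "\<exists>j. P i j" "i \<in> f ` M - g ` M" if "\<pi> (Inr b) = Inl i" for i b
  proof -
    have "\<mu> b * real (s i) > 0" using pos[OF that] by (simp add: m_def)
    then have "s i \<noteq> 0" by (metis mult_zero_right of_nat_0 less_irrefl)
    then show lt: "leaving g f i < leaving f g i" by (simp add: s_def)
    show ex: "\<exists>j. P i j"
    proof (cases "\<pi> (Inl i)")
      case (Inl j)
      then show ?thesis using \<pi>inj[of "Inl i" "Inr b"] that by (auto simp: P_def)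
    next
      case (Inr b')
      then show ?thesis using pos[OF Inr] lt by (simp add: m_def d_def)
    qed
    have "i \<notin> g ` M"
    proof
      assume "i \<in> g ` M"
      then obtain i' where "P i' i" using PM by blast
      then show False using \<pi>inj[of "Inl i'" "Inr b"] that by (simp add: P_def)
    qed
    then show "i \<in> f ` M - g ` M" using ex inf by blast
  qed
  have sink: "leaving f g i < leaving g f i" if i: "i \<in> g ` M - f ` M" for i
  proof -
    obtain i' where i': "P i' i" using i PM by blast
    have no: "\<not> P i j" for j using inf i by blast
    show ?thesis
    proof (cases "\<pi> (Inl i)")
      case (Inl j)
      then have "j = i" using no by (auto simp: P_def)
      then show ?thesis using \<pi>inj[of "Inl i" "Inl i'"] i' Inl by (auto simp: P_def)
    next
      case (Inr b)
      have "\<mu> b * real (d i) > 0" using pos[OF Inr] by (simp add: m_def)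
      then have "d i \<noteq> 0" by (metis mult_zero_right of_nat_0 less_irrefl)
      then show ?thesis by (simp add: d_def)
    qed
  qed
  have ex: "exchange f g M"
    unfolding exchange_def
  proof (intro conjI ballI injM)
    show "f x \<noteq> g x" if "x \<in> M" for x using PM[OF that] by (simp add: P_def)
    show "leaving g f i < leaving f g i" if "i \<in> f ` M - g ` M" for i using start[OF that] hub(1) by blast
  qed (rule sink)
  have two: "card (f ` M - g ` M) \<le> 2"
  proof -
    have "f ` M - g ` M \<subseteq> (\<lambda>b. projl (\<pi> (Inr b))) ` UNIV"
    proof
      fix i assume "i \<in> f ` M - g ` M"
      then obtain b where "\<pi> (Inr b) = Inl i" using start by blast
      then show "i \<in> (\<lambda>b. projl (\<pi> (Inr b))) ` UNIV" by (intro image_eqI[of _ _ b]) simp_all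
    qed
    then have "card (f ` M - g ` M) \<le> card (UNIV :: bool set)"
      by (meson card_image_le card_mono finite finite_imageI le_trans)
    then show ?thesis by simp
  qed
  have outc: "i \<in> f ` M" if "leaving f g i = c" for i
  proof (cases "\<pi> (Inl i)")
    case (Inl j)
    have "j \<noteq> i" using pos[OF Inl] that by (auto simp: m_def)
    then show ?thesis using inf Inl by (auto simp: P_def)
  next
    case (Inr b)
    then show ?thesis using pos[OF Inr] that deg(2)[of i] by (simp add: m_def d_def)
  qed
  have inc: "i \<in> g ` M" if "leaving g f i = c" for i
  proof -
    obtain u where u: "\<pi> u = Inl i" using \<pi>(1) by (metis bij_pointE)
    show ?thesis
    proof (cases u)
      case (Inl j)
      have "j \<noteq> i" using pos[OF u] that Inl by (auto simp: m_def)
      then show ?thesis using ing u Inl by (auto simp: P_def)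
    next
      case (Inr b)
      then show ?thesis using pos[OF u] that deg(1)[of i] by (simp add: m_def s_def)
    qed
  qed
  have hub_ex: "\<exists>i. \<pi> (Inr b) = Inl i" if "\<mu> b * H = c" for b
  proof (cases "\<pi> (Inr b)")
    case (Inr b')
    then show ?thesis using pos[OF Inr] that by (auto simp: m_def split: if_splits)
  qed simp
  \<comment> \<open>A saturated hub is not fixed and cannot go to the other hub, so it starts a
    path. One hub is saturated if the surplus is at least \<open>c\<close>, and both if it is
    \<open>2 * c\<close>; below \<open>c\<close> the bound \<open>2 * c - 2\<close> already
    holds.\<close>
  have "excess f g \<le> 2 * c - 2 + card (f ` M - g ` M)"
  proof (cases "excess f g \<ge> c")
    case True
    then have "\<mu> False * H = c" using \<mu>F by (simp add: H_def)
    then obtain i where i: "\<pi> (Inr False) = Inl i" using hub_ex by blast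
    show ?thesis
    proof (cases "excess f g = 2 * c")
      case eq: True
      then have "\<mu> True * H = c" using \<mu>T by (simp add: H_def)
      then obtain j where j: "\<pi> (Inr True) = Inl j" using hub_ex by blast
      have "i \<noteq> j" using i j \<pi>inj[of "Inr False" "Inr True"] by auto
      then have "card {i, j} = 2" by simp
      moreover have "card {i, j} \<le> card (f ` M - g ` M)"
        using hub(3)[OF i] hub(3)[OF j] by (intro card_mono) auto
      ultimately show ?thesis using eq \<open>c > 0\<close> by linarith
    next
      case False
      have "card {i} \<le> card (f ` M - g ` M)"
        using hub(3)[OF i] by (intro card_mono) auto
      then have "1 \<le> card (f ` M - g ` M)" by simp
      then show ?thesis using False exc \<open>c > 0\<close> by linarith
    qed
  qed (use \<open>c > 0\<close> in linarith)
  then show thesis using that ex two outc inc by blast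
qed

text \<open>Here \<open>a\<close> bounds all degrees, while \<open>c\<close> bounds those away from
  \<open>i0\<close> and half of the surplus. As long as \<open>c < a\<close>, at most one step
  lowers \<open>a\<close> by one; for \<open>c = a\<close>, two steps lower both by one.\<close>

lemma reach_bound:
  fixes f g :: "'n::finite \<Rightarrow> 'k::finite"
  assumes "feasible \<kappa>p \<kappa>m f" "feasible \<kappa>p \<kappa>m g" "c \<le> a"
    and "\<And>i. leaving f g i \<le> a" "\<And>i. leaving g f i \<le> a"
    and "\<And>i. i \<noteq> i0 \<Longrightarrow> leaving f g i \<le> c" "\<And>i. i \<noteq> i0 \<Longrightarrow> leaving g f i \<le> c"
    and "excess f g \<le> 2 * c"
  shows "reach \<kappa>p \<kappa>m (a + c) f g"
  using assms
proof (induction "a + c" arbitrary: f a c rule: less_induct)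
  case less
  note feas = less.prems(1,2)
  show ?case
  proof (cases "a = 0")
    case True
    then have "(\<Sum>i\<in>UNIV. leaving f g i) = 0" using less.prems(4) by simp
    then have "{x. f x \<noteq> g x} = {}" unfolding sum_leaving by simp
    then have "f = g" by auto
    then show ?thesis by (simp add: reach_refl)
  next
    case False
    then have "a > 0" by simp
    obtain M where M: "exchange f g M" "card (f ` M - g ` M) \<le> 2"
      "\<And>i. leaving f g i = a \<Longrightarrow> i \<in> f ` M" "\<And>i. leaving g f i = a \<Longrightarrow> i \<in> g ` M"
      "excess f g \<le> 2 * a - 2 + card (f ` M - g ` M)"
      using exchange_exists[OF \<open>a > 0\<close> less.prems(4,5)] less.prems(3,8) by auto
    show ?thesis
    proof (cases "c = a")
      case True
      let ?h = "override_on f g M"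
      have le: "leaving ?h g i \<le> a - 1" "leaving g ?h i \<le> a - 1" for i
        using leaving_exchange[OF M(1), of i] M(3,4)[of i] less.prems(4,5)[of i]
        by (cases "leaving f g i = a", simp_all) (cases "leaving g f i = a", simp_all)
      have "excess ?h g \<le> 2 * (a - 1)" using excess_exchange[OF M(1)] M(5) by simp
      then have "reach \<kappa>p \<kappa>m ((a - 1) + (a - 1)) ?h g"
        using feasible_exchange[OF feas M(1)] feas(2) le \<open>a > 0\<close> True
        by (intro less.hyps) auto
      then have "reach \<kappa>p \<kappa>m (2 + ((a - 1) + (a - 1))) f g"
        using reach_trans[OF reach_two_exchange[OF feas M(1,2)]] by blast
      then show ?thesis using \<open>a > 0\<close> True by (elim reach_mono) simp
    next
      case ca: False
      then have "c \<le> a - 1" "c < a" using less.prems(3) by auto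
      \<comment> \<open>For \<open>c < a\<close> only \<open>i0\<close> can have degree
        \<open>a\<close>, so the component of the cover through \<open>i0\<close> is enough. If
        neither degree of \<open>i0\<close> equals \<open>a\<close>, the empty exchange will
        do.\<close>
      have "\<exists>C. exchange f g C \<and> linked f g C \<and> (leaving f g i0 = a \<longrightarrow> i0 \<in> f ` C) \<and>
          (leaving g f i0 = a \<longrightarrow> i0 \<in> g ` C)"
      proof (cases "leaving f g i0 = a \<or> leaving g f i0 = a")
        case False
        then show ?thesis by (intro exI[of _ "{}"]) (simp add: exchange_def linked_def)
      next
        case True
        obtain x where x: "x \<in> M" "leaving f g i0 = a \<and> f x = i0 \<or> leaving f g i0 \<noteq> a \<and> g x = i0"
          using M(3,4)[of i0] True by (metis imageE)
        obtain C where C: "x \<in> C" "closed_part f g M C" "linked f g C"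
          by (rule component[OF x(1), of f g])
        \<comment> \<open>If both degrees of \<open>i0\<close> equal \<open>a\<close>, the item
          entering \<open>i0\<close> is adjacent to \<open>x\<close> and thus lies in the same
          component.\<close>
        have both: "i0 \<in> g ` C" if both: "leaving g f i0 = a" "f x = i0"
        proof -
          obtain z where z: "z \<in> M" "g z = i0" using M(4)[OF both(1)] by blast
          then have "z \<in> C" using C(1,2) x(1) both(2) unfolding closed_part_def by auto
          then show ?thesis using z by blast
        qed
        have "i0 \<in> f ` C" if "leaving f g i0 = a"
          using x(2) that C(1) by (metis imageI)
        moreover have "i0 \<in> g ` C" if "leaving g f i0 = a"
          using x(2) that C(1) both by (metis imageI)
        ultimately show ?thesis using exchange_closed_part[OF M(1) C(2)] C(3) by auto
      qed
      then obtain C where C: "exchange f g C" "linked f g C" "leaving f g i0 = a \<Longrightarrow> i0 \<in> f ` C"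
        "leaving g f i0 = a \<Longrightarrow> i0 \<in> g ` C" by blast
      let ?h = "override_on f g C"
      note l = leaving_exchange[OF C(1)]
      have le: "leaving ?h g i \<le> leaving f g i" "leaving g ?h i \<le> leaving g f i" for i
        using l[of i] by linarith+
      have le0: "leaving ?h g i0 \<le> a - 1" "leaving g ?h i0 \<le> a - 1"
        using l[of i0] C(3,4) less.prems(4,5)[of i0]
        by (cases "leaving f g i0 = a", simp_all) (cases "leaving g f i0 = a", simp_all)
      have lec: "leaving ?h g i \<le> c" "leaving g ?h i \<le> c" if "i \<noteq> i0" for i
        using le[of i] less.prems(6,7)[OF that] by linarith+
      have lea: "leaving ?h g i \<le> a - 1" "leaving g ?h i \<le> a - 1" for i
        using le0 lec[of i] \<open>c \<le> a - 1\<close> by (cases "i = i0"; simp)+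
      have "excess ?h g \<le> 2 * c" using excess_exchange[OF C(1)] less.prems(8) by simp
      then have "reach \<kappa>p \<kappa>m ((a - 1) + c) ?h g"
        using feasible_exchange[OF feas C(1)] feas(2) lea lec \<open>c \<le> a - 1\<close> \<open>a > 0\<close>
        by (intro less.hyps) auto
      then have "reach \<kappa>p \<kappa>m (1 + ((a - 1) + c)) f g"
        using reach_trans[OF reach_one_exchange[OF feas C(1,2)]] by blast
      then show ?thesis using \<open>a > 0\<close> by (elim reach_mono) simp
    qed
  qed
qed

section \<open>Estimating the surplus by the size bounds\<close>

lemma abs_leaving_diff_le:
  assumes "feasible \<kappa>p \<kappa>m f" "feasible \<kappa>p \<kappa>m g"
  shows "\<bar>real (leaving f g i) - real (leaving g f i)\<bar> \<le> real (\<kappa>p i) - real (\<kappa>m i)"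
proof -
  have "\<kappa>m i \<le> cnt f i" "cnt f i \<le> \<kappa>p i" "\<kappa>m i \<le> cnt g i" "cnt g i \<le> \<kappa>p i"
    using assms by (auto simp: feasible_def)
  then show ?thesis using cnt_leaving[of f i g] by linarith
qed

lemma two_excess: "2 * real (excess f g) = (\<Sum>i\<in>UNIV. \<bar>real (leaving f g i) - real (leaving g f i)\<bar>)"
  for f g :: "'n::finite \<Rightarrow> 'k::finite"
proof -
  have "2 * real (excess f g) = real (excess f g) + real (excess g f)" by (simp add: excess_commute)
  also have "\<dots> = (\<Sum>i\<in>UNIV. real (leaving f g i - leaving g f i) + real (leaving g f i - leaving f g i))"
    by (simp add: excess_def sum.distrib)
  also have "\<dots> = (\<Sum>i\<in>UNIV. \<bar>real (leaving f g i) - real (leaving g f i)\<bar>)"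
    by (intro sum.cong) auto
  finally show ?thesis .
qed

theorem theorem4:
  fixes \<kappa>p \<kappa>m :: "'k::finite \<Rightarrow> nat" and e :: "nat \<Rightarrow> 'k" and i1 :: 'k
  assumes "CARD('k) \<ge> 2"
    and "\<And>i. \<kappa>m i \<le> \<kappa>p i"
    and "bij_betw e {1..CARD('k)} UNIV"
    and "\<And>r s. 1 \<le> r \<Longrightarrow> r \<le> s \<Longrightarrow> s \<le> CARD('k) \<Longrightarrow> \<kappa>p (e s) \<le> \<kappa>p (e r)"
    and "\<And>i. \<kappa>p i1 - \<kappa>m i1 \<le> \<kappa>p i - \<kappa>m i"
    and "(\<Sum>i\<in>UNIV. \<kappa>p i) > CARD('n::finite) + CARD('k) - 2"
    and "\<And>i. i \<noteq> i1 \<Longrightarrow> \<kappa>p i > \<kappa>m i"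
  shows "ereal_of_enat
      (circuit_diameter (bpp_A :: real^('k \<times> 'n)^'n) bpp_b bpp_B (bpp_d \<kappa>p \<kappa>m))
    \<le> ereal (real (\<kappa>p (e 1))
        + max (real (\<kappa>p (e 2))) (1 / 2 * (\<Sum>i\<in>UNIV - {i1}. real (\<kappa>p i) - real (\<kappa>m i)))
        + 2 * (real CARD('k) - 2))"
proof -
  define S where "S = (\<Sum>i\<in>UNIV - {i1}. real (\<kappa>p i) - real (\<kappa>m i))"
  define B where "B = real (\<kappa>p (e 1)) + max (real (\<kappa>p (e 2))) (1 / 2 * S) + 2 * (real CARD('k) - 2)"
  have k12: "\<kappa>p (e 2) \<le> \<kappa>p (e 1)" using assms(1,4) by simp
  have le1: "\<kappa>p i \<le> \<kappa>p (e 1)" and le2: "i \<noteq> e 1 \<Longrightarrow> \<kappa>p i \<le> \<kappa>p (e 2)" for i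
  proof -
    have "i \<in> e ` {1..CARD('k)}" using assms(3) by (simp add: bij_betw_def)
    then obtain s where s: "1 \<le> s" "s \<le> CARD('k)" "i = e s" by auto
    then show "\<kappa>p i \<le> \<kappa>p (e 1)" using assms(4)[of 1 s] by simp
    show "\<kappa>p i \<le> \<kappa>p (e 2)" if "i \<noteq> e 1"
    proof -
      have "s \<noteq> 1" using that s by auto
      then show ?thesis using assms(4)[of 2 s] s by simp
    qed
  qed
  have main: "\<exists>n. reach \<kappa>p \<kappa>m n f g \<and> real n \<le> B"
    if feas: "feasible \<kappa>p \<kappa>m f" "feasible \<kappa>p \<kappa>m g" for f g :: "'n \<Rightarrow> 'k"
  proof -
    \<comment> \<open>The second argument is half of the surplus, rounded up.\<close>
    define c where "c = max (\<kappa>p (e 2)) ((excess f g + 1) div 2)"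
    define a where "a = max (\<kappa>p (e 1)) c"
    have lv: "leaving f g i \<le> \<kappa>p i" "leaving g f i \<le> \<kappa>p i" for i
      using leaving_le_cnt[of f g i] leaving_le_cnt[of g f i] feas unfolding feasible_def
      by (meson le_trans)+
    have "reach \<kappa>p \<kappa>m (a + c) f g"
    proof (rule reach_bound[OF feas, where ?i0.0 = "e 1"])
      show "leaving f g i \<le> a" "leaving g f i \<le> a" for i
        using lv[of i] le1[of i] by (auto simp: a_def)
      show "leaving f g i \<le> c" "leaving g f i \<le> c" if "i \<noteq> e 1" for i
        using lv[of i] le2[OF that] by (auto simp: c_def)
    qed (auto simp: a_def c_def)
    moreover have "real (a + c) \<le> B"
    \<comment> \<open>For two clusters the term \<open>2 * (k - 2)\<close> gives no room for
      rounding. There the whole surplus comes from a single cluster and is at most the second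
      largest bound, so \<open>c\<close> and \<open>a\<close> equal the two upper bounds.\<close>
    proof (cases "CARD('k) = 2")
      case True
      have "inj_on e {1..CARD('k)}" using assms(3) by (simp add: bij_betw_def)
      then have "e 1 \<noteq> e 2" using inj_onD[of e "{1..CARD('k)}" 1 2] assms(1) by auto
      have "{e 1, e 2} = UNIV"
        using True \<open>e 1 \<noteq> e 2\<close> by (intro card_subset_eq) auto
      then have "excess f g = (\<Sum>i\<in>{e 1, e 2}. leaving f g i - leaving g f i)"
        "(\<Sum>i\<in>{e 1, e 2}. leaving f g i) = (\<Sum>i\<in>{e 1, e 2}. leaving g f i)"
        using sum_leaving[of f g] sum_leaving[of g f] by (auto simp: excess_def eq_commute)
      then have "excess f g \<le> \<kappa>p (e 2)"
        using lv[of "e 2"] \<open>e 1 \<noteq> e 2\<close> by simp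
      then have "c = \<kappa>p (e 2)" by (auto simp: c_def)
      then have "a = \<kappa>p (e 1)" using k12 by (simp add: a_def)
      then show ?thesis using \<open>c = \<kappa>p (e 2)\<close> True by (simp add: B_def)
    next
      case False
      define K where "K = real CARD('k)"
      have K: "K \<ge> 3" using False assms(1) by (simp add: K_def)
      have "2 * real (excess f g) \<le> (\<Sum>i\<in>UNIV. real (\<kappa>p i) - real (\<kappa>m i))"
        unfolding two_excess by (intro sum_mono abs_leaving_diff_le[OF feas])
      also have "\<dots> = (real (\<kappa>p i1) - real (\<kappa>m i1)) + S"
        by (simp add: S_def sum.remove)
      \<comment> \<open>By minimality the slack of \<open>i1\<close> is at most that of
        \<open>e 2\<close>, hence at most its upper bound. This accounts for the summand absent from
        \<open>S\<close>.\<close>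
      also have "real (\<kappa>p i1) - real (\<kappa>m i1) \<le> real (\<kappa>p (e 2))"
        using assms(2)[of i1] assms(2)[of "e 2"] assms(5)[of "e 2"] by linarith
      finally have H: "2 * real (excess f g) \<le> real (\<kappa>p (e 2)) + S" by simp
      have "2 * ((excess f g + 1) div 2) \<le> excess f g + 1" by simp
      then have "2 * real ((excess f g + 1) div 2) \<le> real (excess f g) + 1" by linarith
      then have c4: "4 * real ((excess f g + 1) div 2) \<le> real (\<kappa>p (e 2)) + S + 2" using H by linarith
      define k1 where "k1 = real (\<kappa>p (e 1))"
      define Q where "Q = max (real (\<kappa>p (e 2))) (1 / 2 * S)"
      have Q: "real (\<kappa>p (e 2)) \<le> Q" "1 / 2 * S \<le> Q" by (auto simp: Q_def)
      have B: "B \<ge> k1 + Q + 2"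
        using K unfolding B_def Q_def[symmetric] K_def[symmetric] k1_def[symmetric] by simp
      have Q0: "Q \<ge> 0" using Q(1) by (meson of_nat_0_le_iff order_trans)
      have cQ: "real c \<le> Q + 1" unfolding c_def using Q Q0 c4 by (auto simp: max_def)
      \<comment> \<open>Either the largest cluster determines \<open>a\<close>, and \<open>c\<close>
        exceeds \<open>Q\<close> by at most 1, or \<open>a = c\<close>, and \<open>2 * c\<close> is
        at most half of \<open>\<kappa>p (e 2) + S + 2\<close>. The slack of at least 2 in
        \<open>B\<close> absorbs the rounding in both cases.\<close>
      have "a = \<kappa>p (e 1) \<or> a = c \<and> c = (excess f g + 1) div 2"
        unfolding a_def c_def using k12 by (auto simp: max_def)
      then show ?thesis
      proof
        assume "a = \<kappa>p (e 1)"
        then show ?thesis using cQ B by (simp add: k1_def)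
      next
        assume ac: "a = c \<and> c = (excess f g + 1) div 2"
        then have "4 * real c \<le> real (\<kappa>p (e 2)) + S + 2" "real (a + c) = 2 * real c"
          using c4 by simp_all
        moreover have "real (\<kappa>p (e 2)) \<le> k1" "0 \<le> k1" using k12 by (simp_all add: k1_def)
        ultimately show ?thesis using B Q by linarith
      qed
    qed
    ultimately show ?thesis by blast
  qed
  \<comment> \<open>Step counts are integers, so the real bound may be rounded down to obtain an
    \<open>enat\<close>.\<close>
  have "circuit_diameter (bpp_A :: real^('k \<times> 'n)^'n) bpp_b bpp_B (bpp_d \<kappa>p \<kappa>m) \<le> enat (nat \<lfloor>B\<rfloor>)"
    unfolding circuit_diameter_def BPP_eq_polyhedron_of[symmetric]
  proof (rule Sup_least, safe)
    fix u v :: "real^('k \<times> 'n)"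
    assume "u extreme_point_of BPP \<kappa>p \<kappa>m" "v extreme_point_of BPP \<kappa>p \<kappa>m"
    then obtain f g where fg: "u = incidence f" "feasible \<kappa>p \<kappa>m f" "v = incidence g" "feasible \<kappa>p \<kappa>m g"
      using extreme_point_incidence by metis
    obtain n where n: "reach \<kappa>p \<kappa>m n f g" "real n \<le> B" using main[OF fg(2,4)] by blast
    then obtain m where m: "m \<le> n" "(f, g) \<in> moves \<kappa>p \<kappa>m ^^ m" unfolding reach_def by blast
    have "circuit_distance bpp_A bpp_b bpp_B (bpp_d \<kappa>p \<kappa>m) u v \<le> enat m"
      using circuit_distance_le[OF m(2) fg(2)] fg by simp
    also have "enat m \<le> enat (nat \<lfloor>B\<rfloor>)"
    proof -
      have "real m \<le> B" using m(1) n(2) by simp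
      then show ?thesis by (simp add: le_nat_floor)
    qed
    finally show "circuit_distance bpp_A bpp_b bpp_B (bpp_d \<kappa>p \<kappa>m) u v \<le> enat (nat \<lfloor>B\<rfloor>)" .
  qed
  then have "ereal_of_enat (circuit_diameter (bpp_A :: real^('k \<times> 'n)^'n) bpp_b bpp_B (bpp_d \<kappa>p \<kappa>m))
      \<le> ereal (real (nat \<lfloor>B\<rfloor>))"
    by (metis ereal_of_enat_le_iff ereal_of_enat_simps(1))
  also have "\<dots> \<le> ereal B"
  proof -
    have "B \<ge> 0" using assms(1) by (simp add: B_def max_def)
    then show ?thesis by simp
  qed
  finally show ?thesis by (simp add: B_def S_def)
qed

end
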